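(* Let $P_0(r)=r^8+64r^6+1152r^4+9216r^2+36864$, $\Phi_2(r)=\dfrac{r^2(r^2+24)}{\sqrt{P_0(r)}}$, and $$u_{\pm3}=\frac{-24r\,(r^6+32r^4+384r^2+1536)}{P_0^{3/2}},\qquad v_{\pm3}=\frac{\pm r}{\sqrt{P_0}} .$$ For every $m\in\mathbb{Z}\setminus\{2,-2\}$, every solution $(u,v)^T$ of the homogeneous problem $\mathcal{L}_{2,m}\binom uv=0$ on $(0,\infty)$ which is bounded on $(0,\infty)$ (real-valued $u,v$; i.e. defined on all of $\mathbb{R}^2$ and bounded as functions of $r=|z|$) belongs to $$\mathrm{Span}_{\mathbb{R}}\left\{\binom{0}{\Phi_2},\ \binom{\Phi_2'}{-\frac2r\Phi_2},\ \binom{\Phi_2'}{\frac2r\Phi_2},\ \binom{u_3}{v_3},\ \binom{u_{-3}}{v_{-3}}\right\}.$$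
   Context: For $m\in\mathbb{Z}$ the operator $\mathcal{L}_{2,m}$ acts on pairs of real-valued functions $(u,v)^T$ of $r\in(0,\infty)$ by $$\mathcal{L}_{2,m}\binom uv=\binom{-u''-\frac1ru'+\mathfrak{B}u'+\frac{m^2}{r^2}u+(\mathfrak{C}+\mathfrak{D})u+m\mathfrak{A}v}{-v''-\frac1rv'+\mathfrak{B}v'+\frac{m^2}{r^2}v+(\mathfrak{C}-\mathfrak{D})v+m\mathfrak{A}u},$$ where, with $n=2$ and $\Phi=\Phi_2$, $$\mathfrak{A}=\frac{4n}{r^2}\frac1{2-\Phi^2},\qquad \mathfrak{B}=-\frac{2\Phi\Phi'}{2-\Phi^2},$$ $$\mathfrak{C}=\frac{n^2}{r^2}\frac4{(2-\Phi^2)^2}-\frac{(\Phi')^2\Phi^2}{(2-\Phi^2)^2}-\frac32\Phi^4+3\Phi^2-1,$$ $$\mathfrak{D}=\frac{n^2}{r^2}\frac{2\Phi^2}{(2-\Phi^2)^2}-\frac{2(\Phi')^2}{(2-\Phi^2)^2}-\Phi^4+\frac32\Phi^2 .$$ (This is the Fourier-mode-$m$ part of the linearization of the complex sine-Gordon II equation at its degree-2 vortex $\Phi_2(r)e^{2i\theta}$.) *)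

theory Defs
  imports "HOL-Analysis.Analysis"
begin

definition P0 :: "real \<Rightarrow> real" where
  "P0 r = r ^ 8 + 64 * r ^ 6 + 1152 * r ^ 4 + 9216 * r ^ 2 + 36864"

definition Phi2 :: "real \<Rightarrow> real" where
  "Phi2 r = r ^ 2 * (r ^ 2 + 24) / sqrt (P0 r)"

definition coeffA :: "nat \<Rightarrow> (real \<Rightarrow> real) \<Rightarrow> real \<Rightarrow> real" where
  "coeffA n \<Phi> r = 4 * real n / r ^ 2 * (1 / (2 - \<Phi> r ^ 2))"

definition coeffB :: "(real \<Rightarrow> real) \<Rightarrow> real \<Rightarrow> real" where
  "coeffB \<Phi> r = - (2 * \<Phi> r * deriv \<Phi> r / (2 - \<Phi> r ^ 2))"

definition coeffC :: "nat \<Rightarrow> (real \<Rightarrow> real) \<Rightarrow> real \<Rightarrow> real" where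
  "coeffC n \<Phi> r =
     real n ^ 2 / r ^ 2 * (4 / (2 - \<Phi> r ^ 2) ^ 2)
     - deriv \<Phi> r ^ 2 * \<Phi> r ^ 2 / (2 - \<Phi> r ^ 2) ^ 2
     - 3 / 2 * \<Phi> r ^ 4 + 3 * \<Phi> r ^ 2 - 1"

definition coeffD :: "nat \<Rightarrow> (real \<Rightarrow> real) \<Rightarrow> real \<Rightarrow> real" where
  "coeffD n \<Phi> r =
     real n ^ 2 / r ^ 2 * (2 * \<Phi> r ^ 2 / (2 - \<Phi> r ^ 2) ^ 2)
     - 2 * deriv \<Phi> r ^ 2 / (2 - \<Phi> r ^ 2) ^ 2
     - \<Phi> r ^ 4 + 3 / 2 * \<Phi> r ^ 2"

definition vortex_mode_op ::
    "nat \<Rightarrow> (real \<Rightarrow> real) \<Rightarrow> int \<Rightarrow> (real \<Rightarrow> real) \<Rightarrow> (real \<Rightarrow> real) \<Rightarrow> real \<Rightarrow> real \<times> real" where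
  "vortex_mode_op n \<Phi> m u v r =
     (- deriv (deriv u) r - 1 / r * deriv u r + coeffB \<Phi> r * deriv u r
        + real_of_int m ^ 2 / r ^ 2 * u r + (coeffC n \<Phi> r + coeffD n \<Phi> r) * u r
        + real_of_int m * coeffA n \<Phi> r * v r,
      - deriv (deriv v) r - 1 / r * deriv v r + coeffB \<Phi> r * deriv v r
        + real_of_int m ^ 2 / r ^ 2 * v r + (coeffC n \<Phi> r - coeffD n \<Phi> r) * v r
        + real_of_int m * coeffA n \<Phi> r * u r)"

definition L2 :: "int \<Rightarrow> (real \<Rightarrow> real) \<Rightarrow> (real \<Rightarrow> real) \<Rightarrow> real \<Rightarrow> real \<times> real" where
  "L2 = vortex_mode_op 2 Phi2"

text \<open>
  The library \<open>deriv\<close> is a total function, so classical solutions need explicit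
  differentiability. Continuity of the second derivatives is not assumed: it follows
  from the equation.
\<close>

definition twice_diff_on :: "real set \<Rightarrow> (real \<Rightarrow> real) \<Rightarrow> bool" where
  "twice_diff_on S f \<longleftrightarrow>
     (\<forall>x\<in>S. f field_differentiable (at x) \<and> deriv f field_differentiable (at x))"

definition homogeneous_solution :: "int \<Rightarrow> (real \<Rightarrow> real) \<Rightarrow> (real \<Rightarrow> real) \<Rightarrow> bool" where
  "homogeneous_solution m u v \<longleftrightarrow>
     twice_diff_on {0<..} u \<and> twice_diff_on {0<..} v \<and> (\<forall>r>0. L2 m u v r = (0, 0))"

definition u3 :: "real \<Rightarrow> real" where
  "u3 r = - 24 * r * (r ^ 6 + 32 * r ^ 4 + 384 * r ^ 2 + 1536) / P0 r powr (3 / 2)"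

definition v3 :: "real \<Rightarrow> real" where
  "v3 r = r / sqrt (P0 r)"

text \<open>
  Real span of a set of functions regarded as functions on \<open>S\<close> only: values outside \<open>S\<close>
  are ignored.
\<close>

definition span_fun_on :: "'a set \<Rightarrow> ('a \<Rightarrow> 'b::real_vector) set \<Rightarrow> ('a \<Rightarrow> 'b) set" where
  "span_fun_on S B =
     {f. \<exists>T c. finite T \<and> T \<subseteq> B \<and> (\<forall>x\<in>S. f x = (\<Sum>g\<in>T. c g *\<^sub>R g x))}"

end

theory Submission
  imports Defs
begin

text \<open>
  Multiplied by \<open>r\<^sup>2\<close> and written with the Euler derivative \<open>r d/dr\<close>, the mode operator becomes, for
  \<open>m \<noteq> 0\<close> and after replacing \<open>u\<close> by \<open>- sgn m * u\<close>, a cooperative elliptic system: its off-diagonal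
  coefficient is \<open>- \<bar>m\<bar> r\<^sup>2 \<AA> < 0\<close>. Hence the maximum principle applies. Given a positive
  supersolution \<open>(U, V)\<close>, a bounded solution \<open>(f, g)\<close> that is somewhere positive lies below some
  \<open>M (U, V)\<close> with \<open>M > 0\<close> and touches it at an inner point; logarithmic barriers at both ends keep
  the contact point inside a compact interval, as no indicial exponent vanishes at \<open>0\<close> when \<open>m \<noteq> \<plusminus>2\<close>.
  If \<open>(U, V)\<close> is strict, this is a contradiction, and \<open>(f, g) = 0\<close>; if \<open>(U, V)\<close> is itself a solution,
  then \<open>(f, g) = M (U, V)\<close> by uniqueness for the initial value problem. For \<open>\<bar>m\<bar> = 1\<close> and \<open>\<bar>m\<bar> = 3\<close> the
  known kernel elements are positive after the sign flip; for \<open>m = 0\<close> the system decouples, with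
  strict supersolution \<open>1\<close> for \<open>u\<close> and positive solution \<open>Phi2\<close> for \<open>v\<close>; for \<open>\<bar>m\<bar> \<ge> 4\<close> an explicit
  rational strict supersolution exists.
\<close>

section \<open>The maximum principle for cooperative systems\<close>

definition euler :: "(real \<Rightarrow> real) \<Rightarrow> real \<Rightarrow> real" where
  "euler f r = r * deriv f r"

text \<open>The coupling is subtracted, so cooperativity means that \<open>k\<close> is nonnegative.
  The second row of a system is the same operator with \<open>f\<close> and \<open>g\<close>
  exchanged and its own \<open>c\<close>.\<close>

definition elliptic ::
    "(real \<Rightarrow> real) \<Rightarrow> (real \<Rightarrow> real) \<Rightarrow> (real \<Rightarrow> real) \<Rightarrow> (real \<Rightarrow> real) \<Rightarrow> (real \<Rightarrow> real) \<Rightarrow> real \<Rightarrow> real" where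
  "elliptic b c k f g r = - euler (euler f) r + b r * euler f r + c r * f r - k r * g r"

lemma twice_diff_derivs:
  assumes "twice_diff_on {0<..} f" "r > 0"
  shows "(f has_real_derivative deriv f r) (at r)"
    and "(deriv f has_real_derivative deriv (deriv f) r) (at r)"
    and "(f has_real_derivative euler f r / r) (at r)"
    and "(euler f has_real_derivative euler (euler f) r / r) (at r)"
    and "euler (euler f) r = r * deriv f r + r\<^sup>2 * deriv (deriv f) r"
proof -
  show f: "(f has_real_derivative deriv f r) (at r)"
    and f': "(deriv f has_real_derivative deriv (deriv f) r) (at r)"
    using assms by (auto simp: twice_diff_on_def DERIV_deriv_iff_field_differentiable)
  show "(f has_real_derivative euler f r / r) (at r)"
    using f assms by (simp add: euler_def)
  have "((\<lambda>x. x * deriv f x) has_real_derivative deriv f r + r * deriv (deriv f) r) (at r)"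
    by (auto intro!: derivative_eq_intros f')
  then have e: "(euler f has_real_derivative deriv f r + r * deriv (deriv f) r) (at r)"
    by (simp add: euler_def[abs_def])
  then show e': "euler (euler f) r = r * deriv f r + r\<^sup>2 * deriv (deriv f) r"
    using DERIV_imp_deriv[OF e] by (simp add: euler_def[of "euler f"] algebra_simps power2_eq_square)
  show "(euler f has_real_derivative euler (euler f) r / r) (at r)"
    using e assms unfolding e' by (simp add: add_divide_distrib power2_eq_square)
qed

text \<open>Derivatives in the form \<open>f1 r / r\<close> can be chained, so two derivative facts
  give both Euler derivatives of an explicit function such as a barrier or a weighted
  polynomial.\<close>

lemma twice_diff_eulerI:
  assumes "\<And>r. r > 0 \<Longrightarrow> (f has_real_derivative f1 r / r) (at r)"
    and "\<And>r. r > 0 \<Longrightarrow> (f1 has_real_derivative f2 r / r) (at r)"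
  shows "twice_diff_on {0<..} f"
    and "r > 0 \<Longrightarrow> euler f r = f1 r"
    and "r > 0 \<Longrightarrow> euler (euler f) r = f2 r"
proof -
  have f': "deriv f x = f1 x / x" if "x > 0" for x
    using DERIV_imp_deriv[OF assms(1)] that by simp
  have f'': "(deriv f has_real_derivative (f2 x - f1 x) / x\<^sup>2) (at x)" if "x > 0" for x
  proof (rule DERIV_cong_ev[THEN iffD1])
    show "((\<lambda>x. f1 x / x) has_real_derivative (f2 x - f1 x) / x\<^sup>2) (at x)"
      using that by (auto intro!: derivative_eq_intros assms(2) simp: power2_eq_square)
    have "\<forall>\<^sub>F y in nhds x. y \<in> {0<..}"
      using that by (intro eventually_nhds_in_open) auto
    then show "\<forall>\<^sub>F y in nhds x. f1 y / y = deriv f y"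
      by eventually_elim (simp add: f')
  qed auto
  show td: "twice_diff_on {0<..} f"
    using assms(1) f'' unfolding twice_diff_on_def field_differentiable_def by blast
  show "euler f r = f1 r" if "r > 0" using that by (simp add: euler_def f')
  show "euler (euler f) r = f2 r" if "r > 0"
    using twice_diff_derivs(5)[OF td that] DERIV_imp_deriv[OF f''[OF that]] that
    by (simp add: f' field_simps power2_eq_square)
qed

lemma
  assumes f: "twice_diff_on {0<..} f" and g: "twice_diff_on {0<..} g"
  shows twice_diff_comb: "twice_diff_on {0<..} (\<lambda>r. x * f r + y * g r)"
    and euler_comb: "r > 0 \<Longrightarrow> euler (\<lambda>r. x * f r + y * g r) r = x * euler f r + y * euler g r"
    and euler2_comb: "r > 0 \<Longrightarrow>
      euler (euler (\<lambda>r. x * f r + y * g r)) r = x * euler (euler f) r + y * euler (euler g) r"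
proof -
  have 1: "((\<lambda>r. x * f r + y * g r) has_real_derivative (x * euler f r + y * euler g r) / r) (at r)"
    if "r > 0" for r
    by (rule derivative_eq_intros twice_diff_derivs(3) f g that refl)+ (simp add: add_divide_distrib mult.commute)
  have 2: "((\<lambda>r. x * euler f r + y * euler g r) has_real_derivative
      (x * euler (euler f) r + y * euler (euler g) r) / r) (at r)"
    if "r > 0" for r
    by (rule derivative_eq_intros twice_diff_derivs(4) f g that refl)+ (simp add: add_divide_distrib mult.commute)
  show "twice_diff_on {0<..} (\<lambda>r. x * f r + y * g r)"
    "r > 0 \<Longrightarrow> euler (\<lambda>r. x * f r + y * g r) r = x * euler f r + y * euler g r"
    "r > 0 \<Longrightarrow> euler (euler (\<lambda>r. x * f r + y * g r)) r = x * euler (euler f) r + y * euler (euler g) r"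
    using twice_diff_eulerI[OF 1 2] by auto
qed

lemma elliptic_comb:
  assumes "twice_diff_on {0<..} f" "twice_diff_on {0<..} f'" "r > 0"
  shows "elliptic b c k (\<lambda>r. x * f r + y * f' r) (\<lambda>r. x * g r + y * g' r) r
    = x * elliptic b c k f g r + y * elliptic b c k f' g' r"
  using assms by (simp add: elliptic_def euler_comb euler2_comb algebra_simps)

lemma twice_diff_continuous_on:
  assumes "twice_diff_on {0<..} f" "S \<subseteq> {0<..}"
  shows "continuous_on S f"
  using twice_diff_derivs(1)[OF assms(1)] assms(2)
  by (meson DERIV_isCont continuous_at_imp_continuous_on greaterThan_iff subsetD)

text \<open>If \<open>l\<close> were negative, \<open>f'\<close> would be below
  \<open>f' r = 0\<close> just to the right of \<open>r\<close>, and \<open>f\<close> would drop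
  below its minimum. The second derivative enters only at the point \<open>r\<close>, so it need not
  be continuous.\<close>

lemma interior_min_second_deriv:
  fixes f :: "real \<Rightarrow> real"
  assumes "a < r" "r < b" and min: "\<And>x. a < x \<Longrightarrow> x < b \<Longrightarrow> f r \<le> f x"
    and f': "\<And>x. a < x \<Longrightarrow> x < b \<Longrightarrow> (f has_real_derivative f' x) (at x)"
    and f'': "(f' has_real_derivative l) (at r)"
  shows "f' r = 0" "l \<ge> 0"
proof -
  show f'0: "f' r = 0"
  proof (rule DERIV_local_min[OF f'[of r]])
    show "0 < min (r - a) (b - r)" using assms by simp
    show "\<forall>y. \<bar>r - y\<bar> < min (r - a) (b - r) \<longrightarrow> f r \<le> f y"
      using min by auto
  qed (use assms in auto)
  show "l \<ge> 0"
  proof (rule ccontr)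
    assume "\<not> l \<ge> 0"
    then obtain d where d: "d > 0" "\<And>h. 0 < h \<Longrightarrow> h < d \<Longrightarrow> f' (r + h) < f' r"
      using DERIV_neg_dec_right[OF f''] by auto
    \<comment> \<open>Half the admissible distance keeps \<open>y\<close> below \<open>b\<close> and
      within \<open>d\<close> of \<open>r\<close>.\<close>
    define y where "y = r + min d (b - r) / 2"
    have y: "r < y" "y < b" "y - r < d" using d(1) assms by (auto simp: y_def min_def field_simps)
    have "f y < f r"
    proof (rule DERIV_neg_imp_decreasing_open[OF y(1)])
      fix x assume x: "r < x" "x < y"
      then show "\<exists>z. (f has_real_derivative z) (at x) \<and> z < 0"
        using d(2)[of "x - r"] f'[of x] f'0 y assms by force
    next
      show "continuous_on {r..y} f"
        by (rule continuous_at_imp_continuous_on) (use y assms in \<open>auto intro!: DERIV_isCont[OF f']\<close>)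
    qed
    moreover have "a < y" using y(1) assms(1) by simp
    ultimately show False using min[of y] y(2) by simp
  qed
qed

text \<open>At a zero that is a minimum, \<open>f\<close> and its first derivative vanish and the
  second Euler derivative is \<open>r\<^sup>2\<close> times a nonnegative number, so only the
  coupling term survives.\<close>

lemma elliptic_touch:
  assumes f: "twice_diff_on {0<..} f" and r: "0 < a" "a < r" "r < b"
    and nonneg: "\<And>x. a < x \<Longrightarrow> x < b \<Longrightarrow> f x \<ge> 0" and "f r = 0"
  shows "euler f r = 0" "elliptic b' c k f g r \<le> - k r * g r"
proof -
  have *: "deriv f r = 0" "deriv (deriv f) r \<ge> 0"
  proof -
    have a: "\<And>x. a < x \<Longrightarrow> x < b \<Longrightarrow> f r \<le> f x" using nonneg \<open>f r = 0\<close> by simp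
    have b: "\<And>x. a < x \<Longrightarrow> x < b \<Longrightarrow> (f has_real_derivative deriv f x) (at x)"
      using twice_diff_derivs(1)[OF f] r by auto
    have c: "(deriv f has_real_derivative deriv (deriv f) r) (at r)"
      using twice_diff_derivs(2)[OF f] r by auto
    show "deriv f r = 0" "deriv (deriv f) r \<ge> 0"
      using interior_min_second_deriv[OF r(2,3) a b c] by auto
  qed
  then show "euler f r = 0" by (simp add: euler_def)
  show "elliptic b' c k f g r \<le> - k r * g r"
    using * twice_diff_derivs(5)[OF f, of r] r \<open>f r = 0\<close>
    by (simp add: elliptic_def euler_def[of f])
qed

locale cooperative_system =
  fixes b c1 c2 k :: "real \<Rightarrow> real"
  assumes k_nonneg: "\<And>r. r > 0 \<Longrightarrow> k r \<ge> 0"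
begin

text \<open>The inequalities concern \<open>S\<close> only, while differentiability is required on
  the whole half-line, so that the calculus rules apply without reference to
  \<open>S\<close>.\<close>

definition supersolution :: "real set \<Rightarrow> (real \<Rightarrow> real) \<Rightarrow> (real \<Rightarrow> real) \<Rightarrow> bool" where
  "supersolution S f g \<longleftrightarrow> twice_diff_on {0<..} f \<and> twice_diff_on {0<..} g \<and>
     (\<forall>r\<in>S. elliptic b c1 k f g r \<ge> 0 \<and> elliptic b c2 k g f r \<ge> 0)"

definition strict_supersolution :: "real set \<Rightarrow> (real \<Rightarrow> real) \<Rightarrow> (real \<Rightarrow> real) \<Rightarrow> bool" where
  "strict_supersolution S f g \<longleftrightarrow> twice_diff_on {0<..} f \<and> twice_diff_on {0<..} g \<and>
     (\<forall>r\<in>S. elliptic b c1 k f g r > 0 \<and> elliptic b c2 k g f r > 0)"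

definition solution :: "(real \<Rightarrow> real) \<Rightarrow> (real \<Rightarrow> real) \<Rightarrow> bool" where
  "solution f g \<longleftrightarrow> twice_diff_on {0<..} f \<and> twice_diff_on {0<..} g \<and>
     (\<forall>r>0. elliptic b c1 k f g r = 0 \<and> elliptic b c2 k g f r = 0)"

lemma solution_imp_supersolution: "solution f g \<Longrightarrow> S \<subseteq> {0<..} \<Longrightarrow> supersolution S f g"
  unfolding solution_def supersolution_def by auto

lemma strict_imp_supersolution: "strict_supersolution S f g \<Longrightarrow> supersolution S f g"
  unfolding strict_supersolution_def supersolution_def by (auto intro: less_imp_le)

lemma supersolution_comb:
  assumes "supersolution S f g" "supersolution S f' g'" "x \<ge> 0" "y \<ge> 0" "S \<subseteq> {0<..}"
  shows "supersolution S (\<lambda>r. x * f r + y * f' r) (\<lambda>r. x * g r + y * g' r)"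
proof -
  have "r > 0" if "r \<in> S" for r using assms(5) that by auto
  then show ?thesis using assms(1-4)
    unfolding supersolution_def by (auto simp: elliptic_comb twice_diff_comb)
qed

lemma strict_supersolution_comb:
  assumes "supersolution S f g" "strict_supersolution S f' g'" "x \<ge> 0" "y > 0" "S \<subseteq> {0<..}"
  shows "strict_supersolution S (\<lambda>r. x * f r + y * f' r) (\<lambda>r. x * g r + y * g' r)"
proof -
  have "r > 0" if "r \<in> S" for r using assms(5) that by auto
  then show ?thesis using assms(1-4)
    unfolding supersolution_def strict_supersolution_def
    by (auto simp: elliptic_comb twice_diff_comb intro!: add_nonneg_pos)
qed

lemma solution_comb:
  assumes "solution f g" "solution f' g'"
  shows "solution (\<lambda>r. x * f r + y * f' r) (\<lambda>r. x * g r + y * g' r)"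
  using assms unfolding solution_def by (auto simp: elliptic_comb twice_diff_comb)

lemma supersolution_subset: "supersolution S f g \<Longrightarrow> S' \<subseteq> S \<Longrightarrow> supersolution S' f g"
  unfolding supersolution_def by auto

text \<open>At a zero of one component the operator is at most \<open>- k r\<close> times the other
  component, hence at most 0 since \<open>k\<close> and both components are nonnegative there;
  strictness forbids this.\<close>

lemma strict_supersolution_no_touch:
  assumes "strict_supersolution S f g" "0 < a" "a < r" "r < d" "r \<in> S"
    and nonneg: "\<And>x. a < x \<Longrightarrow> x < d \<Longrightarrow> f x \<ge> 0 \<and> g x \<ge> 0"
  shows "f r > 0 \<and> g r > 0"
proof -
  have "f r \<ge> 0" "g r \<ge> 0" using nonneg assms by auto
  moreover have "k r \<ge> 0" using k_nonneg assms by auto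
  ultimately have k: "- k r * f r \<le> 0" "- k r * g r \<le> 0" by (simp_all)
  have "f r \<noteq> 0"
  proof
    assume "f r = 0"
    then have "elliptic b c1 k f g r \<le> - k r * g r"
      using elliptic_touch(2)[OF _ assms(2-4)] nonneg assms(1)
      unfolding strict_supersolution_def by blast
    then show False using assms k unfolding strict_supersolution_def by fastforce
  qed
  moreover have "g r \<noteq> 0"
  proof
    assume "g r = 0"
    then have "elliptic b c2 k g f r \<le> - k r * f r"
      using elliptic_touch(2)[OF _ assms(2-4)] nonneg assms(1)
      unfolding strict_supersolution_def by blast
    then show False using assms k unfolding strict_supersolution_def by fastforce
  qed
  ultimately show ?thesis using nonneg assms by force
qed

text \<open>The ratios \<open>f / z\<close> and \<open>g / w\<close> are minimised jointly. A
  negative minimum \<open>h y\<close> would be attained inside, and subtracting \<open>h y\<close>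
  times \<open>(z, w)\<close> from \<open>(f, g)\<close> would give a nonnegative strict
  supersolution with a zero at \<open>y\<close>.\<close>

lemma max_principle:
  assumes "0 < p" "p \<le> q"
    and super: "supersolution {p<..<q} f g"
    and strict: "strict_supersolution {p<..<q} z w"
    and pos: "\<And>x. x \<in> {p..q} \<Longrightarrow> z x > 0 \<and> w x > 0"
    and bdry: "f p \<ge> 0" "g p \<ge> 0" "f q \<ge> 0" "g q \<ge> 0"
    and "x \<in> {p..q}"
  shows "f x \<ge> 0 \<and> g x \<ge> 0"
proof -
  define h where "h = (\<lambda>x. min (f x / z x) (g x / w x))"
  have D: "twice_diff_on {0<..} f" "twice_diff_on {0<..} g" "twice_diff_on {0<..} z" "twice_diff_on {0<..} w"
    using super strict unfolding supersolution_def strict_supersolution_def by auto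
  have sub: "{p..q} \<subseteq> {0<..}" using \<open>0 < p\<close> by auto
  have "continuous_on {p..q} h" unfolding h_def
    using D[THEN twice_diff_continuous_on, OF sub] pos
    by (intro continuous_intros) (auto simp: order_less_le)
  then obtain y where y: "y \<in> {p..q}" "\<And>x. x \<in> {p..q} \<Longrightarrow> h y \<le> h x"
    using continuous_attains_inf[of "{p..q}" h] \<open>p \<le> q\<close> by auto
  have "h y \<ge> 0"
  proof (rule ccontr)
    assume neg: "\<not> h y \<ge> 0"
    then have "h y \<noteq> h p" "h y \<noteq> h q" using bdry pos[of p] pos[of q] \<open>p \<le> q\<close>
      by (auto simp: h_def min_def)
    then have "y \<noteq> p" "y \<noteq> q" by auto
    then have y': "p < y" "y < q" using y(1) by auto
    define F G where "F = (\<lambda>x. 1 * f x + (- h y) * z x)" and "G = (\<lambda>x. 1 * g x + (- h y) * w x)"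
    have "strict_supersolution {p<..<q} F G"
      unfolding F_def G_def
      by (rule strict_supersolution_comb[OF super strict]) (use neg \<open>0 < p\<close> in auto)
    moreover have nn: "F x \<ge> 0 \<and> G x \<ge> 0" if "p < x" "x < q" for x
      using y(2)[of x] pos[of x] that by (simp add: F_def G_def h_def field_simps)
    ultimately have "F y > 0 \<and> G y > 0"
      using strict_supersolution_no_touch \<open>0 < p\<close> y' by auto
    moreover have "F y = 0 \<or> G y = 0"
      using pos[OF y(1)] by (auto simp: F_def G_def h_def min_def field_simps)
    ultimately show False by auto
  qed
  then have "h x \<ge> 0" using y(2)[OF \<open>x \<in> {p..q}\<close>] by simp
  then show ?thesis using pos[OF \<open>x \<in> {p..q}\<close>]
    by (auto simp: h_def zero_le_divide_iff)
qed

text \<open>Adding \<open>e\<close> times the strict supersolution makes the boundary values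
  nonnegative on an interval that may depend on \<open>e\<close>. The maximum principle applies
  there, and \<open>e\<close> is then made small.\<close>

lemma max_principle_growth:
  assumes super: "supersolution S f g"
    and strict: "strict_supersolution S z w"
    and pos: "\<And>x. x \<in> S \<Longrightarrow> z x > 0 \<and> w x > 0"
    and S: "S \<subseteq> {0<..}" "x \<in> S"
    and ends: "\<And>e. e > 0 \<Longrightarrow> \<exists>p q. p \<le> x \<and> x \<le> q \<and> {p..q} \<subseteq> S \<and>
       f p + e * z p \<ge> 0 \<and> g p + e * w p \<ge> 0 \<and> f q + e * z q \<ge> 0 \<and> g q + e * w q \<ge> 0"
  shows "f x \<ge> 0 \<and> g x \<ge> 0"
proof -
  have *: "f x + e * z x \<ge> 0 \<and> g x + e * w x \<ge> 0" if e: "e > 0" for e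
  proof -
    obtain p q where pq: "p \<le> x" "x \<le> q" "{p..q} \<subseteq> S"
       "f p + e * z p \<ge> 0" "g p + e * w p \<ge> 0" "f q + e * z q \<ge> 0" "g q + e * w q \<ge> 0"
      using ends[OF e] by auto
    define F G where "F = (\<lambda>x. 1 * f x + e * z x)" and "G = (\<lambda>x. 1 * g x + e * w x)"
    have "supersolution S F G" unfolding F_def G_def
      using e S by (intro supersolution_comb[OF super strict_imp_supersolution[OF strict]]) auto
    moreover have "{p<..<q} \<subseteq> S" using pq(3) by (meson greaterThanLessThan_subseteq_atLeastAtMost_iff order.trans order_refl)
    moreover have "0 < p" using pq S by (meson atLeastAtMost_iff greaterThan_iff order.refl order.trans subsetD)
    ultimately have "F x \<ge> 0 \<and> G x \<ge> 0"
      using pq strict pos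
      by (intro max_principle[of p q F G z w])
         (auto simp: F_def G_def strict_supersolution_def supersolution_def subset_iff)
    then show ?thesis by (simp add: F_def G_def)
  qed
  show ?thesis
  proof (rule conjI; rule ccontr)
    assume "\<not> 0 \<le> f x"
    \<comment> \<open>For this \<open>e\<close> the sum equals half of \<open>f x\<close>, which is
      negative.\<close>
    then show False using *[of "- f x / (2 * z x)"] pos[OF S(2)] by (simp add: field_simps)
  next
    assume "\<not> 0 \<le> g x"
    then show False using *[of "- g x / (2 * w x)"] pos[OF S(2)] by (simp add: field_simps)
  qed
qed

end

text \<open>Barriers blow up at the ends, so that a multiple \<open>\<epsilon>\<close> of them dominates any bounded solution there;
  no asymptotic expansion of solutions at \<open>0\<close> or \<open>\<infinity>\<close> is needed.\<close>

locale barrier_system = cooperative_system +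
  fixes y1 y2 z1 z2 :: "real \<Rightarrow> real" and p0 q0 :: real
  assumes p0: "0 < p0" "p0 < q0"
    and inner: "strict_supersolution {0<..p0} y1 y2"
    and inner_pos: "\<And>r. 0 < r \<Longrightarrow> r \<le> p0 \<Longrightarrow> y1 r > 0 \<and> y2 r > 0"
    and inner_lim: "filterlim y1 at_top (at_right 0)" "filterlim y2 at_top (at_right 0)"
    and outer: "strict_supersolution {q0..} z1 z2"
    and outer_pos: "\<And>r. q0 \<le> r \<Longrightarrow> z1 r > 0 \<and> z2 r > 0"
    and outer_lim: "filterlim z1 at_top at_top" "filterlim z2 at_top at_top"
begin

text \<open>Where the barrier exceeds \<open>B / e\<close>, its multiple by \<open>e\<close>
  compensates the lower bound \<open>- B\<close>; such a point \<open>p\<close> exists below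
  \<open>x\<close>. At the other end \<open>p0\<close> the sign is given.\<close>

lemma inner_nonneg:
  assumes super: "supersolution {0<..p0} f g"
    and bound: "\<And>r. r > 0 \<Longrightarrow> f r \<ge> - B \<and> g r \<ge> - B"
    and core: "f p0 \<ge> 0" "g p0 \<ge> 0" and x: "0 < x" "x \<le> p0"
  shows "f x \<ge> 0 \<and> g x \<ge> 0"
proof (rule max_principle_growth[OF super inner])
  fix e :: real assume e: "e > 0"
  have "\<forall>\<^sub>F r in at_right 0. r \<in> {0<..<x} \<and> y1 r \<ge> B / e \<and> y2 r \<ge> B / e"
    using inner_lim[THEN filterlim_at_top[THEN iffD1, rule_format]]
    by (intro eventually_conj eventually_at_right_real[OF \<open>0 < x\<close>])
  from eventually_happens'[OF trivial_limit_at_right_real this]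
  obtain p where p: "0 < p" "p < x" "y1 p \<ge> B / e" "y2 p \<ge> B / e"
    by auto
  then have "f p + e * y1 p \<ge> 0" "g p + e * y2 p \<ge> 0"
    using bound[of p] e by (auto simp: field_simps)
  moreover have "f p0 + e * y1 p0 \<ge> 0" "g p0 + e * y2 p0 \<ge> 0"
    using core inner_pos[of p0] p0 e by auto
  ultimately show "\<exists>p q. p \<le> x \<and> x \<le> q \<and> {p..q} \<subseteq> {0<..p0} \<and>
       f p + e * y1 p \<ge> 0 \<and> g p + e * y2 p \<ge> 0 \<and> f q + e * y1 q \<ge> 0 \<and> g q + e * y2 q \<ge> 0"
    using p x by (intro exI[of _ p] exI[of _ p0]) auto
qed (use inner_pos x in auto)

lemma outer_nonneg:
  assumes super: "supersolution {q0..} f g"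
    and bound: "\<And>r. r > 0 \<Longrightarrow> f r \<ge> - B \<and> g r \<ge> - B"
    and core: "f q0 \<ge> 0" "g q0 \<ge> 0" and x: "q0 \<le> x"
  shows "f x \<ge> 0 \<and> g x \<ge> 0"
proof (rule max_principle_growth[OF super outer])
  fix e :: real assume e: "e > 0"
  have "\<forall>\<^sub>F r in at_top. r > x \<and> z1 r \<ge> B / e \<and> z2 r \<ge> B / e"
    using outer_lim[THEN filterlim_at_top[THEN iffD1, rule_format]]
    by (intro eventually_conj eventually_gt_at_top)
  from eventually_happens'[OF trivial_limit_at_top_linorder this]
  obtain q where q: "x < q" "z1 q \<ge> B / e" "z2 q \<ge> B / e"
    by auto
  then have "f q + e * z1 q \<ge> 0" "g q + e * z2 q \<ge> 0"
    using bound[of q] e x p0 by (auto simp: field_simps)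
  moreover have "f q0 + e * z1 q0 \<ge> 0" "g q0 + e * z2 q0 \<ge> 0"
    using core outer_pos[of q0] e by auto
  ultimately show "\<exists>p q. p \<le> x \<and> x \<le> q \<and> {p..q} \<subseteq> {q0..} \<and>
       f p + e * z1 p \<ge> 0 \<and> g p + e * z2 p \<ge> 0 \<and> f q + e * z1 q \<ge> 0 \<and> g q + e * z2 q \<ge> 0"
    using q x by (intro exI[of _ q0] exI[of _ q]) auto
qed (use outer_pos x p0 in auto)

text \<open>This reduces every comparison to the compact interval from \<open>p0\<close> to
  \<open>q0\<close>, where continuous ratios attain their extrema.\<close>

lemma nonneg_from_core:
  assumes super: "supersolution {0<..} f g"
    and bound: "\<And>r. r > 0 \<Longrightarrow> f r \<ge> - B \<and> g r \<ge> - B"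
    and core: "\<And>r. p0 \<le> r \<Longrightarrow> r \<le> q0 \<Longrightarrow> f r \<ge> 0 \<and> g r \<ge> 0" and "x > 0"
  shows "f x \<ge> 0 \<and> g x \<ge> 0"
proof -
  have "supersolution {0<..p0} f g" "supersolution {q0..} f g"
    using p0 by (auto intro: supersolution_subset[OF super])
  then show ?thesis
    using inner_nonneg[of f g B x] outer_nonneg[of f g B x] core[of x] core[of p0] core[of q0]
      bound p0 \<open>x > 0\<close> by fastforce
qed

text \<open>The constant \<open>M\<close> comes from the maximum of the ratios over the core alone.
  Since \<open>M * U\<close> and \<open>M * V\<close> are nonnegative,
  \<open>M * (U, V) - (f, g)\<close> is bounded below by \<open>- B\<close>, and its sign propagates
  from the core to the half-line.\<close>

lemma bounded_solution_dichotomy: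
  assumes super: "supersolution {0<..} U V"
    and pos: "\<And>r. r > 0 \<Longrightarrow> U r > 0 \<and> V r > 0"
    and sol: "solution f g"
    and bound: "\<And>r. r > 0 \<Longrightarrow> \<bar>f r\<bar> \<le> B \<and> \<bar>g r\<bar> \<le> B"
  shows "(\<forall>r>0. f r \<le> 0 \<and> g r \<le> 0) \<or>
    (\<exists>M>0. (\<forall>r>0. f r \<le> M * U r \<and> g r \<le> M * V r) \<and> (\<exists>x>0. f x = M * U x \<or> g x = M * V x))"
proof -
  define h where "h = (\<lambda>x. max (f x / U x) (g x / V x))"
  have D: "twice_diff_on {0<..} f" "twice_diff_on {0<..} g" "twice_diff_on {0<..} U" "twice_diff_on {0<..} V"
    using super sol unfolding supersolution_def solution_def by auto
  have sub: "{p0..q0} \<subseteq> {0<..}" using p0 by auto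
  have "continuous_on {p0..q0} h" unfolding h_def
    using D[THEN twice_diff_continuous_on, OF sub] pos p0
    by (intro continuous_intros) (auto simp: order_less_le)
  then obtain y where y: "y \<in> {p0..q0}" "\<And>x. x \<in> {p0..q0} \<Longrightarrow> h x \<le> h y"
    using continuous_attains_sup[of "{p0..q0}" h] p0 by auto
  \<comment> \<open>Truncation at 0 keeps the combination below a supersolution;
    \<open>M = 0\<close> leads to the first alternative.\<close>
  define M where "M = max 0 (h y)"
  have core: "f x \<le> M * U x \<and> g x \<le> M * V x" if "p0 \<le> x" "x \<le> q0" for x
  proof -
    have "f x / U x \<le> M" "g x / V x \<le> M" using y(2)[of x] that by (auto simp: h_def M_def)
    then show ?thesis using pos[of x] p0 that by (auto simp: field_simps)
  qed
  \<comment> \<open>The negative of \<open>f\<close> is written as a linear combination so that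
    \<open>solution_comb\<close> applies; the same shape recurs below.\<close>
  define F G where "F = (\<lambda>x. M * U x + 1 * (- 1 * f x + 0 * f x))"
    and "G = (\<lambda>x. M * V x + 1 * (- 1 * g x + 0 * g x))"
  have "supersolution {0<..} F G" unfolding F_def G_def
    by (rule supersolution_comb[OF super solution_imp_supersolution[OF solution_comb[OF sol sol]]])
      (auto simp: M_def)
  moreover have "F r \<ge> - B \<and> G r \<ge> - B" if "r > 0" for r
  proof -
    have "M * U r \<ge> 0" "M * V r \<ge> 0" using pos[OF that] by (auto simp: M_def)
    then show ?thesis using bound[OF that] by (auto simp: F_def G_def)
  qed
  ultimately have *: "f x \<le> M * U x \<and> g x \<le> M * V x" if "x > 0" for x
    using nonneg_from_core[of F G B x] core that by (auto simp: F_def G_def)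
  show ?thesis
  proof (cases "h y \<le> 0")
    case True
    then show ?thesis using * by (auto simp: M_def)
  next
    case False
    then have "f y = M * U y \<or> g y = M * V y"
      using pos[of y] y(1) p0 by (auto simp: M_def h_def max_def field_simps)
    moreover have "M > 0" "y > 0" using False y(1) p0 by (auto simp: M_def)
    ultimately show ?thesis using * by blast
  qed
qed

lemma bounded_solution_zero:
  assumes strict: "strict_supersolution {0<..} U V"
    and pos: "\<And>r. r > 0 \<Longrightarrow> U r > 0 \<and> V r > 0"
    and sol: "solution f g"
    and bound: "\<And>r. r > 0 \<Longrightarrow> \<bar>f r\<bar> \<le> B \<and> \<bar>g r\<bar> \<le> B"
    and "r > 0"
  shows "f r = 0 \<and> g r = 0"
proof -
  \<comment> \<open>A one-sided claim, to be used for \<open>(f, g)\<close> and for its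
    negative.\<close>
  have *: "\<forall>r>0. f r \<le> 0 \<and> g r \<le> 0" if sol: "solution f g" and
    bound: "\<And>r. r > 0 \<Longrightarrow> \<bar>f r\<bar> \<le> B \<and> \<bar>g r\<bar> \<le> B" for f g
  proof (rule ccontr)
    assume "\<not> ?thesis"
    then obtain M x where M: "M > 0" "\<And>r. r > 0 \<Longrightarrow> f r \<le> M * U r \<and> g r \<le> M * V r"
      "x > 0" "f x = M * U x \<or> g x = M * V x"
      using bounded_solution_dichotomy[OF strict_imp_supersolution[OF strict] pos sol bound] by blast
    define F G where "F = (\<lambda>x. 1 * (- 1 * f x + 0 * f x) + M * U x)"
      and "G = (\<lambda>x. 1 * (- 1 * g x + 0 * g x) + M * V x)"
    \<comment> \<open>The difference \<open>M * (U, V) - (f, g)\<close> inherits strictness because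
      \<open>M > 0\<close>, so the contact at \<open>x\<close> is impossible.\<close>
    have "strict_supersolution {0<..} F G" unfolding F_def G_def
      using M(1)
      by (intro strict_supersolution_comb[OF solution_imp_supersolution[OF solution_comb[OF sol sol]] strict]) auto
    then have "F x > 0 \<and> G x > 0"
      using M by (intro strict_supersolution_no_touch[of "{0<..}" F G "x / 2" x "2 * x"])
        (auto simp: F_def G_def)
    then show False using M(4) by (auto simp: F_def G_def)
  qed
  have "solution (\<lambda>x. - 1 * f x + 0 * f x) (\<lambda>x. - 1 * g x + 0 * g x)"
    by (intro solution_comb sol)
  from *[OF this] *[OF sol bound] bound \<open>r > 0\<close> show ?thesis by force
qed

end

text \<open>Triangle inequality for the terms of the energy derivative below. The factors 2 come
  from \<open>2 * |s * t| <= s^2 + t^2\<close>; only \<open>x\<close>, the damping term with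
  coefficient \<open>b\<close>, is bounded directly.\<close>

lemma energy_derivative_bound:
  fixes a a' x y z v w :: real
  assumes "\<bar>a\<bar> * 2 \<le> e" "\<bar>a'\<bar> * 2 \<le> e" "\<bar>x\<bar> \<le> p" "\<bar>y\<bar> * 2 \<le> q" "\<bar>z\<bar> * 2 \<le> s" "\<bar>v\<bar> * 2 \<le> t" "\<bar>w\<bar> * 2 \<le> t"
  shows "\<bar>2 * (a + a' + x + y + z - v - w)\<bar> \<le> 2 * e + 2 * p + q + s + 2 * t"
proof -
  have *: "2 * \<xi> \<le> \<eta> \<and> - (2 * \<xi>) \<le> \<eta>" if "\<bar>\<xi>\<bar> * 2 \<le> \<eta>" for \<xi> \<eta> :: real
    using that by linarith
  have "x \<le> p" "- x \<le> p" using assms(3) by auto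
  with *[OF assms(1)] *[OF assms(2)] *[OF assms(4)] *[OF assms(5)] *[OF assms(6)] *[OF assms(7)]
  show ?thesis by (intro abs_leI) (simp_all add: algebra_simps)
qed

text \<open>Gronwall's inequality for the energy \<open>f\<^sup>2 + g\<^sup>2 + (r f')\<^sup>2 + (r g')\<^sup>2\<close>.\<close>

lemma (in cooperative_system) solution_unique:
  assumes sol: "solution f g"
    and cont: "continuous_on {0<..} b" "continuous_on {0<..} c1" "continuous_on {0<..} c2" "continuous_on {0<..} k"
    and x: "x > 0" "f x = 0" "g x = 0" "euler f x = 0" "euler g x = 0" and "y > 0"
  shows "f y = 0 \<and> g y = 0"
proof -
  define p q where "p = min x y" and "q = max x y"
  have pq: "0 < p" "p \<le> x" "p \<le> y" "x \<le> q" "y \<le> q" using x \<open>y > 0\<close> by (auto simp: p_def q_def)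
  have D: "twice_diff_on {0<..} f" "twice_diff_on {0<..} g" using sol by (auto simp: solution_def)
  have "continuous_on {p..q} (\<lambda>r. 2 * (1 + \<bar>b r\<bar> + \<bar>c1 r\<bar> + \<bar>c2 r\<bar> + \<bar>k r\<bar>))"
    using pq by (intro continuous_intros continuous_on_subset[OF cont(1)] continuous_on_subset[OF cont(2)]
        continuous_on_subset[OF cont(3)] continuous_on_subset[OF cont(4)]) auto
  then obtain N where N: "\<And>r. p \<le> r \<Longrightarrow> r \<le> q \<Longrightarrow> 2 * (1 + \<bar>b r\<bar> + \<bar>c1 r\<bar> + \<bar>c2 r\<bar> + \<bar>k r\<bar>) \<le> N"
    using continuous_attains_sup[of "{p..q}"] pq by (metis (no_types, lifting) atLeastAtMost_iff compact_Icc empty_iff)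
  define E where "E = (\<lambda>r. (f r)\<^sup>2 + (g r)\<^sup>2 + (euler f r)\<^sup>2 + (euler g r)\<^sup>2)"
  \<comment> \<open>This is \<open>r\<close> times the derivative of \<open>E\<close>.\<close>
  define E' where "E' = (\<lambda>r. 2 * (f r * euler f r + g r * euler g r
     + euler f r * euler (euler f) r + euler g r * euler (euler g) r))"
  have E: "(E has_real_derivative E' r / r) (at r)" if "r > 0" for r
    unfolding E_def E'_def
    by (rule derivative_eq_intros twice_diff_derivs(3,4) D that refl)+ (use that in \<open>simp add: field_simps\<close>)
  have E'_le: "\<bar>E' r\<bar> \<le> N * E r" if "p \<le> r" "r \<le> q" for r
  proof -
    have r: "r > 0" using pq that by auto
    have eqs: "euler (euler f) r = b r * euler f r + c1 r * f r - k r * g r"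
      "euler (euler g) r = b r * euler g r + c2 r * g r - k r * f r"
      using sol r unfolding solution_def elliptic_def by force+
    have *: "\<bar>s * t\<bar> * 2 \<le> E r" if "(s = f r \<and> t = euler f r) \<or> (s = g r \<and> t = euler g r) \<or> (s = f r \<and> t = euler g r)
       \<or> (s = g r \<and> t = euler f r)" for s t
    proof -
      have "\<bar>s * t\<bar> * 2 \<le> s\<^sup>2 + t\<^sup>2"
        using sum_squares_bound[of "\<bar>s\<bar>" "\<bar>t\<bar>"] by (simp add: abs_mult)
      then show ?thesis using that unfolding E_def by (auto intro: order_trans)
    qed
    have "\<bar>f r * euler f r\<bar> * 2 \<le> E r" "\<bar>g r * euler g r\<bar> * 2 \<le> E r"
      "\<bar>f r * euler g r\<bar> * 2 \<le> E r" "\<bar>g r * euler f r\<bar> * 2 \<le> E r"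
      by (rule *, simp)+
    then have **: "\<bar>c1 r * (f r * euler f r)\<bar> * 2 \<le> \<bar>c1 r\<bar> * E r" "\<bar>c2 r * (g r * euler g r)\<bar> * 2 \<le> \<bar>c2 r\<bar> * E r"
      "\<bar>k r * (f r * euler g r)\<bar> * 2 \<le> \<bar>k r\<bar> * E r" "\<bar>k r * (g r * euler f r)\<bar> * 2 \<le> \<bar>k r\<bar> * E r"
      by (simp_all add: abs_mult mult_left_mono mult.assoc)
    have "(euler f r)\<^sup>2 + (euler g r)\<^sup>2 \<le> E r" by (simp add: E_def)
    then have b: "\<bar>b r * ((euler f r)\<^sup>2 + (euler g r)\<^sup>2)\<bar> \<le> \<bar>b r\<bar> * E r"
      by (simp add: abs_mult mult_left_mono)
    have nonneg: "0 \<le> \<bar>c1 r\<bar> * E r" "0 \<le> \<bar>c2 r\<bar> * E r" "0 \<le> \<bar>k r\<bar> * E r" "0 \<le> \<bar>b r\<bar> * E r"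
      by (simp_all add: E_def)
    have "E' r = 2 * (f r * euler f r + g r * euler g r + b r * ((euler f r)\<^sup>2 + (euler g r)\<^sup>2)
      + c1 r * (f r * euler f r) + c2 r * (g r * euler g r) - k r * (f r * euler g r) - k r * (g r * euler f r))"
      unfolding E'_def eqs by (simp add: algebra_simps power2_eq_square)
    moreover have "\<bar>f r * euler f r\<bar> * 2 \<le> E r" "\<bar>g r * euler g r\<bar> * 2 \<le> E r"
      by (rule *, simp)+
    ultimately have "\<bar>E' r\<bar> \<le> 2 * E r + 2 * (\<bar>b r\<bar> * E r) + \<bar>c1 r\<bar> * E r + \<bar>c2 r\<bar> * E r + 2 * (\<bar>k r\<bar> * E r)"
      using energy_derivative_bound[OF _ _ b **] by simp
    also have "\<dots> \<le> 2 * (1 + \<bar>b r\<bar> + \<bar>c1 r\<bar> + \<bar>c2 r\<bar> + \<bar>k r\<bar>) * E r"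
      using nonneg by (simp add: algebra_simps)
    also have "\<dots> \<le> N * E r"
      using N[OF that] by (intro mult_right_mono) (auto simp: E_def)
    finally show ?thesis .
  qed
  have "E x = 0" using x by (simp add: E_def)
  have "E y \<le> 0"
  proof (cases "x \<le> y")
    case True
    \<comment> \<open>As the bound is on \<open>r * dE/dr\<close>, the integrating factor is a power
      of \<open>r\<close> instead of an exponential.\<close>
    have "E y * y powr (- N) \<le> E x * x powr (- N)"
    proof (rule DERIV_nonpos_imp_nonincreasing[OF True])
      fix r assume r: "x \<le> r" "r \<le> y"
      then have "r > 0" "p \<le> r" "r \<le> q" using pq by auto
      then have "((\<lambda>r. E r * r powr (- N)) has_real_derivative (E' r - N * E r) / r * r powr (- N)) (at r)"
        using DERIV_mult[OF E has_real_derivative_powr[of r "- N"]]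
        by (simp add: powr_diff diff_divide_distrib algebra_simps)
      moreover have "(E' r - N * E r) / r * r powr (- N) \<le> 0"
        using E'_le[OF \<open>p \<le> r\<close> \<open>r \<le> q\<close>] \<open>r > 0\<close> by (intro mult_nonpos_nonneg divide_nonpos_pos) auto
      ultimately show "\<exists>D. ((\<lambda>r. E r * r powr (- N)) has_real_derivative D) (at r) \<and> D \<le> 0" by blast
    qed
    then show ?thesis using \<open>E x = 0\<close> \<open>y > 0\<close> by (simp add: mult_le_0_iff)
  next
    case False
    then have "y \<le> x" by simp
    \<comment> \<open>Backwards from \<open>x\<close> the lower bound
      \<open>r * dE/dr >= - N * E\<close> is the relevant one, and the exponent changes
      sign.\<close>
    then have "E y * y powr N \<le> E x * x powr N"
    proof (rule DERIV_nonneg_imp_nondecreasing)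
      fix r assume r: "y \<le> r" "r \<le> x"
      then have "r > 0" "p \<le> r" "r \<le> q" using pq by auto
      then have "((\<lambda>r. E r * r powr N) has_real_derivative (E' r + N * E r) / r * r powr N) (at r)"
        using DERIV_mult[OF E has_real_derivative_powr[of r N]]
        by (simp add: powr_diff add_divide_distrib algebra_simps)
      moreover have "(E' r + N * E r) / r * r powr N \<ge> 0"
        using E'_le[OF \<open>p \<le> r\<close> \<open>r \<le> q\<close>] \<open>r > 0\<close> by (intro mult_nonneg_nonneg divide_nonneg_pos) auto
      ultimately show "\<exists>D. ((\<lambda>r. E r * r powr N) has_real_derivative D) (at r) \<and> 0 \<le> D" by blast
    qed
    then show ?thesis using \<open>E x = 0\<close> \<open>y > 0\<close> by (simp add: mult_le_0_iff)
  qed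
  moreover have "(f y)\<^sup>2 \<le> E y" "(g y)\<^sup>2 \<le> E y" by (auto simp: E_def)
  ultimately have "(f y)\<^sup>2 \<le> 0" "(g y)\<^sup>2 \<le> 0" by linarith+
  then show ?thesis by simp
qed

text \<open>At a contact point one component of \<open>M * (U, V) - (f, g)\<close> vanishes; if
  \<open>k > 0\<close>, the touching inequality makes the other vanish too. Both are minima, so all
  initial data are zero there. The second option in \<open>coupled\<close> covers a scalar equation
  written twice, where both components touch together.\<close>

lemma (in barrier_system) bounded_solution_ground_state:
  assumes UV: "solution U V"
    and pos: "\<And>r. r > 0 \<Longrightarrow> U r > 0 \<and> V r > 0"
    and sol: "solution f g"
    and bound: "\<And>r. r > 0 \<Longrightarrow> \<bar>f r\<bar> \<le> B \<and> \<bar>g r\<bar> \<le> B"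
    and cont: "continuous_on {0<..} b" "continuous_on {0<..} c1" "continuous_on {0<..} c2" "continuous_on {0<..} k"
    and coupled: "(\<forall>r>0. k r > 0) \<or> (f = g \<and> U = V)"
  shows "\<exists>M. \<forall>r>0. f r = M * U r \<and> g r = M * V r"
proof -
  have *: "(\<forall>r>0. f r \<le> 0 \<and> g r \<le> 0) \<or> (\<exists>M. \<forall>r>0. f r = M * U r \<and> g r = M * V r)"
    if sol: "solution f g" and bound: "\<And>r. r > 0 \<Longrightarrow> \<bar>f r\<bar> \<le> B \<and> \<bar>g r\<bar> \<le> B"
      and coupled: "(\<forall>r>0. k r > 0) \<or> (f = g \<and> U = V)" for f g
  proof (cases "\<forall>r>0. f r \<le> 0 \<and> g r \<le> 0")
    case False
    then obtain M x where M: "M > 0" "\<And>r. r > 0 \<Longrightarrow> f r \<le> M * U r \<and> g r \<le> M * V r"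
      "x > 0" "f x = M * U x \<or> g x = M * V x"
      using bounded_solution_dichotomy[OF solution_imp_supersolution[OF UV order_refl] pos sol bound] by blast
    define F G where "F = (\<lambda>x. - 1 * f x + M * U x)" and "G = (\<lambda>x. - 1 * g x + M * V x)"
    have FG: "solution F G" unfolding F_def G_def by (rule solution_comb[OF sol UV])
    then have D: "twice_diff_on {0<..} F" "twice_diff_on {0<..} G" by (auto simp: solution_def)
    have nonneg: "F r \<ge> 0" "G r \<ge> 0" if "r > 0" for r using M(2)[OF that] by (auto simp: F_def G_def)
    have touch: "k x * h x \<le> 0" "euler w x = 0"
      if "w x = 0" "twice_diff_on {0<..} w" "\<And>r. r > 0 \<Longrightarrow> w r \<ge> 0" "elliptic b c k w h x = 0" for c w h
      using elliptic_touch(1)[of w "x / 2" x "2 * x"] elliptic_touch(2)[of w "x / 2" x "2 * x" b c k h] that \<open>x > 0\<close> by auto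
    have zero: "elliptic b c1 k F G x = 0" "elliptic b c2 k G F x = 0"
      using FG \<open>x > 0\<close> by (auto simp: solution_def)
    have "F x = 0 \<and> G x = 0"
    proof (cases "f = g \<and> U = V")
      case True
      then show ?thesis using M(4) by (auto simp: F_def G_def)
    next
      case False
      then have "k x > 0" using coupled \<open>x > 0\<close> by auto
      moreover have "F x = 0 \<or> G x = 0" using M(4) by (auto simp: F_def G_def)
      ultimately show ?thesis
        using touch(1)[OF _ D(1) nonneg(1) zero(1)] touch(1)[OF _ D(2) nonneg(2) zero(2)]
          nonneg[OF \<open>x > 0\<close>] by (auto simp: mult_le_0_iff)
    qed
    then have "F r = 0 \<and> G r = 0" if "r > 0" for r
      using solution_unique[OF FG cont \<open>x > 0\<close> _ _ _ _ that]
        touch(2)[OF _ D(1) nonneg(1) zero(1)] touch(2)[OF _ D(2) nonneg(2) zero(2)] by auto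
    then have "\<forall>r>0. f r = M * U r \<and> g r = M * V r"
      by (auto simp: F_def G_def)
    then show ?thesis by blast
  qed blast
  define f' g' where "f' = (\<lambda>x. - 1 * f x + 0 * f x)" and "g' = (\<lambda>x. - 1 * g x + 0 * g x)"
  have sol': "solution f' g'" unfolding f'_def g'_def by (rule solution_comb[OF sol sol])
  have "(\<forall>r>0. f' r \<le> 0 \<and> g' r \<le> 0) \<or> (\<exists>M. \<forall>r>0. f' r = M * U r \<and> g' r = M * V r)"
    by (rule *[OF sol']) (use bound coupled in \<open>auto simp: f'_def g'_def\<close>)
  then show ?thesis
  proof (elim disjE exE)
    assume "\<forall>r>0. f' r \<le> 0 \<and> g' r \<le> 0"
    \<comment> \<open>If neither \<open>(f, g)\<close> nor its negative is positive anywhere, the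
      solution vanishes and \<open>M = 0\<close> serves.\<close>
    then have "\<forall>r>0. f r = 0 * U r \<and> g r = 0 * V r" if "\<forall>r>0. f r \<le> 0 \<and> g r \<le> 0"
      using that by (auto simp: f'_def g'_def intro: order_antisym)
    then show ?thesis using *[OF sol bound coupled] by blast
  next
    fix M assume M: "\<forall>r>0. f' r = M * U r \<and> g' r = M * V r"
    have "f r = - M * U r \<and> g r = - M * V r" if "r > 0" for r
    proof -
      have "- f r = M * U r" "- g r = M * V r" using M that by (auto simp: f'_def g'_def)
      then show ?thesis by simp
    qed
    then show ?thesis by blast
  qed
qed

section \<open>Polynomial identities and inequalities\<close>

text \<open>This family is closed under \<open>r d/dr\<close>, so differentiating explicit functions
  becomes polynomial arithmetic in \<open>s = r^2\<close>.\<close>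

definition weighted :: "nat \<Rightarrow> real \<Rightarrow> real poly \<Rightarrow> real poly \<Rightarrow> real \<Rightarrow> real" where
  "weighted i \<kappa> Q n r = r ^ i * poly n (r\<^sup>2) * poly Q (r\<^sup>2) powr (- \<kappa>)"

text \<open>The numerator after one Euler derivative, with the exponent raised from
  \<open>\<kappa>\<close> to \<open>\<kappa> + 1\<close>. The factors \<open>[:0, 2:]\<close> and 2
  reflect \<open>r d/dr = 2 s d/ds\<close>.\<close>

definition wstep :: "nat \<Rightarrow> real \<Rightarrow> real poly \<Rightarrow> real poly \<Rightarrow> real poly" where
  "wstep i \<kappa> Q n = (smult (of_nat i) n + [:0, 2:] * pderiv n) * Q - smult (2 * \<kappa>) ([:0, 1:] * n * pderiv Q)"

text \<open>With \<open>s = r\<^sup>2\<close>: \<open>P0 r = polP s\<close>, \<open>Phi2 r = polQ s / sqrt (polP s)\<close>,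
  \<open>deriv Phi2 r = r * polT s / polP s powr (3/2)\<close>, \<open>2 - (Phi2 r)\<^sup>2 = polR s / polP s\<close>.\<close>

definition polP :: "real poly" where "polP = [:36864, 9216, 1152, 64, 1:]"
definition polQ :: "real poly" where "polQ = [:0, 24, 1:]"
definition polT :: "real poly" where "polT = [:1769472, 368640, 27648, 768, 16:]"
definition polR :: "real poly" where "polR = [:73728, 18432, 1728, 80, 1:]"







text \<open>Numerators of \<open>r\<^sup>2 (\<CC> + \<DD>)\<close> and \<open>r\<^sup>2 (\<CC> - \<DD>)\<close> over the denominators
  \<open>polP\<^sup>2 polR\<^sup>2\<close> and \<open>polP\<^sup>2 polR\<close>.\<close>

definition polG1 :: "real poly" where
  "polG1 = smult 8 ((smult 2 polP + polQ\<^sup>2) * polP ^ 3) - [:0, 0, 1:] * polT\<^sup>2 * (polQ\<^sup>2 + smult 2 polP)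
    + [:0, 1/2:] * polR\<^sup>2 * (smult 9 (polQ\<^sup>2 * polP) - smult 5 ((polQ\<^sup>2)\<^sup>2) - smult 2 (polP\<^sup>2))"

definition polG2 :: "real poly" where
  "polG2 = smult 8 (polP ^ 3) + [:0, 0, 1:] * polT\<^sup>2 - [:0, 1/2:] * (polP - polQ\<^sup>2) * polR\<^sup>2"

text \<open>Numerators of the two rows of the mode operator, with the sign of one component flipped,
  on weighted polynomials; see \<open>elliptic_weighted\<close>.\<close>

definition row1 :: "real \<Rightarrow> nat \<Rightarrow> real \<Rightarrow> real poly \<Rightarrow> real poly \<Rightarrow> real poly \<Rightarrow> real poly" where
  "row1 \<mu> i \<kappa> Q n n' = smult (\<mu>\<^sup>2) (polP\<^sup>2 * polR\<^sup>2 * n * Q\<^sup>2) - smult (8 * \<mu>) (polP ^ 3 * polR * n' * Q ^ 3)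
     + (polG1 * n * Q\<^sup>2 - wstep i (\<kappa> + 1) Q (wstep i \<kappa> Q n) * polP\<^sup>2 * polR\<^sup>2
     - [:0, 2:] * polQ * polT * polP * polR * wstep i \<kappa> Q n * Q)"

definition row2 :: "real \<Rightarrow> nat \<Rightarrow> real \<Rightarrow> real poly \<Rightarrow> real poly \<Rightarrow> real poly \<Rightarrow> real poly" where
  "row2 \<mu> i \<kappa> Q n n' = smult (\<mu>\<^sup>2) (polP\<^sup>2 * polR * n * Q\<^sup>2) - smult (8 * \<mu>) (polP ^ 3 * n' * Q)
     + (polG2 * n * Q\<^sup>2 - wstep i (\<kappa> + 1) Q (wstep i \<kappa> Q n) * polP\<^sup>2 * polR
     - [:0, 2:] * polQ * polT * polP * wstep i \<kappa> Q n * Q)"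

text \<open>Expanded once, so that later identities and sign checks work on explicit
  coefficients.\<close>

lemma polG1_eq: "polG1 = [:29548117155177824256, 22161087866383368192, 7387029288794456064, 1801870859506286592,
      491146071691493376, 137114116505468928, 30185227724783616, 4870971265646592, 579773474537472,
      51679831523328, 3478498836480, 176541401088, 6676037632, 183607296, 3525888, 44192, 320, 1:]"
  unfolding polG1_def polP_def polQ_def polT_def polR_def power2_eq_square power3_eq_cube by simp

lemma polG2_eq: "polG2 = [:400771988324352, 200385994162176, 40703405064192, 3391950422016, -125023813632, -59114520576,
      -6370099200, -359792640, -11501568, -219136, -3328, -32:]"
  unfolding polG2_def polP_def polQ_def polT_def polR_def power2_eq_square power3_eq_cube by simp

lemma polR_eq: "polR = smult 2 polP - polQ\<^sup>2"
  unfolding polR_def polP_def polQ_def power2_eq_square power3_eq_cube by simp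

lemmas row_defs = row1_def row2_def wstep_def polG1_eq polG2_eq polP_def polQ_def polT_def polR_def
  power2_eq_square power3_eq_cube

text \<open>Invariance under phase rotation: the numerator is that of \<open>Phi2\<close>. The
  partner \<open>n\<close> is arbitrary because mode 0 has no coupling.\<close>

lemma row_phase: "row2 0 2 (1/2) polP [:24, 1:] n = 0"
  unfolding row_defs by (simp add: pderiv_pCons)

text \<open>Invariance under translation: the pair consists of the derivative of \<open>Phi2\<close>
  and \<open>2 / r * Phi2\<close>, that is, a known kernel element up to the sign flip.\<close>

lemma row_translation:
  "row1 1 1 (3/2) polP polT [:48, 2:] = 0" "row2 1 1 (1/2) polP [:48, 2:] polT = 0"
  unfolding row_defs by (simp_all add: pderiv_pCons)

text \<open>The pair is \<open>(- u3, v3)\<close>; the cubic is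
  \<open>24 * (s^3 + 32 s^2 + 384 s + 1536)\<close>.\<close>

lemma row_mode3:
  "row1 3 1 (3/2) polP [:36864, 9216, 768, 24:] [:1:] = 0"
  "row2 3 1 (1/2) polP [:1:] [:36864, 9216, 768, 24:] = 0"
  unfolding row_defs by (simp_all add: pderiv_pCons)

text \<open>The pair \<open>(r (4 s + 115) / (s + 10)\<^sup>2, 10 r / (s + 10))\<close> was found numerically; it is a strict
  supersolution for all \<open>\<mu> = 4 + j \<ge> 4\<close> at once, and this can be checked coefficient by coefficient:
  each coefficient in \<open>s\<close> is a nonnegative quadratic polynomial in \<open>j \<ge> 0\<close>.\<close>

lemma row1_large:
  "row1 (4 + j) 1 2 [:10, 1:] [:115, 4:] [:10:] =
     [:432141213394475679744000, 483850418416036872192000, 224346387947340378931200,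
      57664304851655898169344, 9039466902032165634048, 908676140321633992704, 78596540587692785664,
      13288436998437076992, 2975967009155579904, 497608427594317824, 59845949899407360,
      5393712270016512, 375526609108992, 20507051196416, 879782632960, 29302012544, 737807828,
      13440800, 165281, 1215, 4:]
     + smult j [:384125523017311715328000, 455041004189738493542400, 257327165275154876989440,
      92019197874222428848128, 23199137011869992091648, 4346530919084973883392,
      620355945958402424832, 67752120238309638144, 5551794726585237504, 317386535617953792,
      9156262738526208, -351389167386624, -63078096306176, -4310148448256, -189471674368,
      -5762866176, -120661280, -1656928, -13384, -48:]
     + smult (j\<^sup>2) [:84950836821136244736000, 104895815900881276108800, 62533511376297818849280,
      23888242002562369191936, 6541390574516359397376, 1360840122638788460544, 222448469158536413184,
      29156786791312785408, 3100603281580228608, 269037560150360064, 19061992467726336,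
      1098734839529472, 51094176022528, 1891131752448, 54606928384, 1195201408, 19011820, 205804,
      1347, 4:]"
proof -
  \<comment> \<open>From \<open>\<mu> = 4 + j\<close> follow \<open>\<mu>^2 = 16 + 8 j + j^2\<close>
    and \<open>8 \<mu> = 32 + 8 j\<close>, whence the factors 8 in the part linear in
    \<open>j\<close>.\<close>
  have "row1 (4 + j) 1 2 [:10, 1:] [:115, 4:] [:10:] = row1 4 1 2 [:10, 1:] [:115, 4:] [:10:]
     + smult j (smult 8 (polP\<^sup>2 * polR\<^sup>2 * [:115, 4:] * [:10, 1:]\<^sup>2) - smult 8 (polP ^ 3 * polR * [:10:] * [:10, 1:] ^ 3))
     + smult (j\<^sup>2) (polP\<^sup>2 * polR\<^sup>2 * [:115, 4:] * [:10, 1:]\<^sup>2)"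
    unfolding row1_def
    by (simp only: power2_sum smult_add_left smult_diff_right distrib_left smult_smult) (simp add: algebra_simps)
  also have "row1 4 1 2 [:10, 1:] [:115, 4:] [:10:] = [:432141213394475679744000, 483850418416036872192000, 224346387947340378931200,
      57664304851655898169344, 9039466902032165634048, 908676140321633992704, 78596540587692785664,
      13288436998437076992, 2975967009155579904, 497608427594317824, 59845949899407360,
      5393712270016512, 375526609108992, 20507051196416, 879782632960, 29302012544, 737807828,
      13440800, 165281, 1215, 4:]"
    unfolding row_defs by (simp add: pderiv_pCons)
  also have "smult 8 (polP\<^sup>2 * polR\<^sup>2 * [:115, 4:] * [:10, 1:]\<^sup>2) - smult 8 (polP ^ 3 * polR * [:10:] * [:10, 1:] ^ 3)
     = [:384125523017311715328000, 455041004189738493542400, 257327165275154876989440,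
      92019197874222428848128, 23199137011869992091648, 4346530919084973883392,
      620355945958402424832, 67752120238309638144, 5551794726585237504, 317386535617953792,
      9156262738526208, -351389167386624, -63078096306176, -4310148448256, -189471674368,
      -5762866176, -120661280, -1656928, -13384, -48:]"
    unfolding row_defs by (simp add: pderiv_pCons)
  also have "polP\<^sup>2 * polR\<^sup>2 * [:115, 4:] * [:10, 1:]\<^sup>2 = [:84950836821136244736000, 104895815900881276108800, 62533511376297818849280,
      23888242002562369191936, 6541390574516359397376, 1360840122638788460544, 222448469158536413184,
      29156786791312785408, 3100603281580228608, 269037560150360064, 19061992467726336,
      1098734839529472, 51094176022528, 1891131752448, 54606928384, 1195201408, 19011820, 205804,
      1347, 4:]"
    unfolding row_defs by (simp add: pderiv_pCons)
  finally show ?thesis .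
qed

text \<open>In contrast to the first row, the part linear in \<open>j\<close> has only positive
  coefficients, so no discriminant is involved.\<close>

lemma row2_large:
  "row2 (4 + j) 1 1 [:10, 1:] [:10:] [:115, 4:] =
     [:60115798248652800, 157303005417308160, 81914037176107008, 22741201144774656,
      4261539968188416, 602848521879552, 68383382962176, 6320648355840, 467153584128, 26580123648,
      1106610688, 31515520, 560088, 5464, 22:]
     + smult j [:340656190075699200, 353681279696240640, 169601695809011712, 50584939401314304,
      10512850237784064, 1608306338562048, 186268268888064, 16529605263360, 1124288888832,
      57985482752, 2212554752, 59735040, 1059152, 10856, 48:]
     + smult (j\<^sup>2) [:100192997081088000, 95183347227033600, 43427402172334080, 12558044139356160,
      2557280570572800, 385752823234560, 44194898903040, 3882457497600, 260979425280, 13250723840,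
      495306240, 13056640, 226280, 2280, 10:]"
proof -
  have "row2 (4 + j) 1 1 [:10, 1:] [:10:] [:115, 4:] = row2 4 1 1 [:10, 1:] [:10:] [:115, 4:]
     + smult j (smult 8 (polP\<^sup>2 * polR * [:10:] * [:10, 1:]\<^sup>2) - smult 8 (polP ^ 3 * [:115, 4:] * [:10, 1:]))
     + smult (j\<^sup>2) (polP\<^sup>2 * polR * [:10:] * [:10, 1:]\<^sup>2)"
    unfolding row2_def
    by (simp only: power2_sum smult_add_left smult_diff_right distrib_left smult_smult) (simp add: algebra_simps)
  also have "row2 4 1 1 [:10, 1:] [:10:] [:115, 4:] = [:60115798248652800, 157303005417308160, 81914037176107008, 22741201144774656,
      4261539968188416, 602848521879552, 68383382962176, 6320648355840, 467153584128, 26580123648,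
      1106610688, 31515520, 560088, 5464, 22:]"
    unfolding row_defs by (simp add: pderiv_pCons)
  also have "smult 8 (polP\<^sup>2 * polR * [:10:] * [:10, 1:]\<^sup>2) - smult 8 (polP ^ 3 * [:115, 4:] * [:10, 1:])
     = [:340656190075699200, 353681279696240640, 169601695809011712, 50584939401314304,
      10512850237784064, 1608306338562048, 186268268888064, 16529605263360, 1124288888832,
      57985482752, 2212554752, 59735040, 1059152, 10856, 48:]"
    unfolding row_defs by simp
  also have "polP\<^sup>2 * polR * [:10:] * [:10, 1:]\<^sup>2 = [:100192997081088000, 95183347227033600, 43427402172334080, 12558044139356160,
      2557280570572800, 385752823234560, 44194898903040, 3882457497600, 260979425280, 13250723840,
      495306240, 13056640, 226280, 2280, 10:]"
    unfolding row_defs by simp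
  finally show ?thesis .
qed

lemma poly_pCons_nonneg: "a \<ge> 0 \<Longrightarrow> poly p s \<ge> 0 \<Longrightarrow> s \<ge> 0 \<Longrightarrow> poly (pCons a p) (s::real) \<ge> 0"
  by simp

lemma poly_pCons_pos: "a > 0 \<Longrightarrow> poly p s \<ge> 0 \<Longrightarrow> s \<ge> 0 \<Longrightarrow> poly (pCons a p) (s::real) > 0"
  by (simp add: add_pos_nonneg)

lemma poly_0_nonneg: "poly 0 (s::real) \<ge> 0"
  by simp

lemmas poly_positivity = poly_pCons_pos poly_pCons_nonneg poly_0_nonneg

text \<open>For negative \<open>b\<close>, complete the square after multiplying by
  \<open>4 * c\<close>.\<close>

lemma quadratic_nonneg:
  fixes a b c x :: real
  assumes "a \<ge> 0" "c \<ge> 0" "x \<ge> 0" "0 \<le> b \<or> b\<^sup>2 \<le> 4 * a * c"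
  shows "a + x * b + x\<^sup>2 * c \<ge> 0"
proof (cases "b \<ge> 0")
  case True
  then show ?thesis using assms by simp
next
  case False
  then have b: "0 < b\<^sup>2" "b\<^sup>2 \<le> 4 * a * c" using assms by auto
  then have "c \<noteq> 0" by auto
  have "4 * c * (a + x * b + x\<^sup>2 * c) = (2 * c * x + b)\<^sup>2 + (4 * a * c - b\<^sup>2)"
    by (simp add: power2_eq_square algebra_simps)
  also have "\<dots> \<ge> 0" using b by simp
  finally show ?thesis using \<open>c \<noteq> 0\<close> assms by (simp add: zero_le_mult_iff)
qed

text \<open>Horner's rule in \<open>s\<close> for a polynomial whose coefficients are quadratics in
  \<open>j\<close>: the next two lemmas peel off one such coefficient at a time, the strict one
  serving for the constant term.\<close>

lemma poly_quadratic_pCons: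
  "poly (pCons a p) s + j * poly (pCons b q) s + j\<^sup>2 * poly (pCons c w) s
    = (a + j * b + j\<^sup>2 * c) + s * (poly p s + j * poly q s + j\<^sup>2 * poly w (s::real))"
  by (simp add: algebra_simps)

lemma poly_quadratic_nonneg:
  fixes s j :: real
  assumes "a \<ge> 0" "c \<ge> 0" "j \<ge> 0" "0 \<le> b \<or> b\<^sup>2 \<le> 4 * a * c" "s \<ge> 0"
    "0 \<le> poly p s + j * poly q s + j\<^sup>2 * poly w s"
  shows "0 \<le> poly (pCons a p) s + j * poly (pCons b q) s + j\<^sup>2 * poly (pCons c w) s"
  unfolding poly_quadratic_pCons
  using assms by (intro add_nonneg_nonneg[OF quadratic_nonneg mult_nonneg_nonneg])

lemma poly_quadratic_pos:
  fixes s j :: real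
  assumes "a > 0" "c \<ge> 0" "j \<ge> 0" "b \<ge> 0" "s \<ge> 0"
    "0 \<le> poly p s + j * poly q s + j\<^sup>2 * poly w s"
  shows "0 < poly (pCons a p) s + j * poly (pCons b q) s + j\<^sup>2 * poly (pCons c w) s"
  unfolding poly_quadratic_pCons using assms by (intro add_pos_nonneg mult_nonneg_nonneg) auto

lemma poly_row1_large_pos:
  assumes "j \<ge> 0" "s > 0"
  shows "poly (row1 (4 + j) 1 2 [:10, 1:] [:115, 4:] [:10:]) s > 0"
  unfolding row1_large poly_add poly_smult
  by (intro poly_quadratic_pos poly_quadratic_nonneg) (use assms in auto)

lemma poly_row2_large_pos:
  assumes "j \<ge> 0" "s > 0"
  shows "poly (row2 (4 + j) 1 1 [:10, 1:] [:10:] [:115, 4:]) s > 0"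
  unfolding row2_large poly_add poly_smult using assms
  by (intro add_pos_nonneg mult_nonneg_nonneg poly_positivity) auto

section \<open>The mode operators at the vortex\<close>

lemma weighted_deriv:
  assumes "r > 0" "poly Q (r\<^sup>2) > 0"
  shows "(weighted i \<kappa> Q n has_real_derivative weighted i (\<kappa> + 1) Q (wstep i \<kappa> Q n) r / r) (at r)"
proof -
  have sq: "((\<lambda>r. r\<^sup>2) has_real_derivative 2 * r) (at r)"
    by (auto intro!: derivative_eq_intros)
  have n: "((\<lambda>r. poly n (r\<^sup>2)) has_real_derivative poly (pderiv n) (r\<^sup>2) * (2 * r)) (at r)"
    and Q: "((\<lambda>r. poly Q (r\<^sup>2)) has_real_derivative poly (pderiv Q) (r\<^sup>2) * (2 * r)) (at r)"
    by (rule DERIV_chain2[OF poly_DERIV sq])+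
  \<comment> \<open>For \<open>i = 0\<close> the truncated exponent is harmless because the factor
    \<open>real i\<close> vanishes.\<close>
  have pow: "real i * r ^ (i - Suc 0) = real i * r ^ i / r"
    using assms by (cases i) auto
  have Qp: "((\<lambda>r. poly Q (r\<^sup>2) powr (- \<kappa>)) has_real_derivative
      - \<kappa> * poly Q (r\<^sup>2) powr (- \<kappa> - 1) * (poly (pderiv Q) (r\<^sup>2) * (2 * r))) (at r)"
    using DERIV_fun_powr[OF Q assms(2), of "- \<kappa>"] by simp
  have ri: "((\<lambda>r. r ^ i) has_real_derivative real i * r ^ i / r) (at r)"
    by (rule derivative_eq_intros refl)+ (simp add: pow)
  have e: "poly Q (r\<^sup>2) powr (- \<kappa>) = poly Q (r\<^sup>2) * poly Q (r\<^sup>2) powr (- \<kappa> - 1)"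
    using assms by (simp add: powr_diff)
  have e': "- (\<kappa> + 1) = - \<kappa> - 1" by simp
  have "weighted i \<kappa> Q n = (\<lambda>r. r ^ i * poly n (r\<^sup>2) * poly Q (r\<^sup>2) powr (- \<kappa>))"
    by (simp add: weighted_def[abs_def])
  moreover have "((\<lambda>r. r ^ i * poly n (r\<^sup>2) * poly Q (r\<^sup>2) powr (- \<kappa>)) has_real_derivative
      weighted i (\<kappa> + 1) Q (wstep i \<kappa> Q n) r / r) (at r)"
    by (rule DERIV_cong[OF DERIV_mult[OF DERIV_mult[OF ri n] Qp]], unfold weighted_def wstep_def e e')
      (use assms in \<open>simp add: field_simps power2_eq_square\<close>)
  ultimately show ?thesis by simp
qed

lemma
  assumes "\<And>s. s > 0 \<Longrightarrow> poly Q s > 0"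
  shows twice_diff_weighted: "twice_diff_on {0<..} (weighted i \<kappa> Q n)"
    and euler_weighted: "r > 0 \<Longrightarrow> euler (weighted i \<kappa> Q n) r = weighted i (\<kappa> + 1) Q (wstep i \<kappa> Q n) r"
    and euler2_weighted: "r > 0 \<Longrightarrow> euler (euler (weighted i \<kappa> Q n)) r
      = weighted i (\<kappa> + 2) Q (wstep i (\<kappa> + 1) Q (wstep i \<kappa> Q n)) r"
proof -
  have 1: "(weighted i \<kappa> Q n has_real_derivative weighted i (\<kappa> + 1) Q (wstep i \<kappa> Q n) r / r) (at r)"
    if "r > 0" for r using weighted_deriv that assms by simp
  have 2: "(weighted i (\<kappa> + 1) Q (wstep i \<kappa> Q n) has_real_derivative
     weighted i (\<kappa> + 2) Q (wstep i (\<kappa> + 1) Q (wstep i \<kappa> Q n)) r / r) (at r)"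
    if "r > 0" for r using weighted_deriv[of r Q i "\<kappa> + 1"] that assms by (simp add: add.assoc)
  show "twice_diff_on {0<..} (weighted i \<kappa> Q n)"
    by (rule twice_diff_eulerI(1)[OF 1 2])
  show "r > 0 \<Longrightarrow> euler (weighted i \<kappa> Q n) r = weighted i (\<kappa> + 1) Q (wstep i \<kappa> Q n) r"
    by (rule twice_diff_eulerI(2)[OF 1 2])
  show "r > 0 \<Longrightarrow> euler (euler (weighted i \<kappa> Q n)) r
      = weighted i (\<kappa> + 2) Q (wstep i (\<kappa> + 1) Q (wstep i \<kappa> Q n)) r"
    by (rule twice_diff_eulerI(3)[OF 1 2])
qed

lemma polP_pos: "s \<ge> 0 \<Longrightarrow> poly polP s > 0"
  and polR_pos: "s \<ge> 0 \<Longrightarrow> poly polR s > 0"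
  and polT_pos: "s \<ge> 0 \<Longrightarrow> poly polT s > 0"
  unfolding polP_def polR_def polT_def by (intro poly_positivity; simp)+

text \<open>The coefficients of the mode operator after multiplication by \<open>r^2\<close>:
  \<open>beta\<close> is \<open>r\<close> times \<open>coeffB\<close>, while \<open>alpha\<close>,
  \<open>gam1\<close> and \<open>gam2\<close> are \<open>r^2\<close> times \<open>coeffA\<close> and
  the sum and difference of \<open>coeffC\<close> and \<open>coeffD\<close>. As rational functions
  they extend continuously to 0.\<close>

definition beta :: "real \<Rightarrow> real" where
  "beta r = - 2 * r\<^sup>2 * poly polQ (r\<^sup>2) * poly polT (r\<^sup>2) / (poly polP (r\<^sup>2) * poly polR (r\<^sup>2))"
definition alpha :: "real \<Rightarrow> real" where
  "alpha r = 8 * poly polP (r\<^sup>2) / poly polR (r\<^sup>2)"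
definition gam1 :: "real \<Rightarrow> real" where
  "gam1 r = poly polG1 (r\<^sup>2) / ((poly polP (r\<^sup>2))\<^sup>2 * (poly polR (r\<^sup>2))\<^sup>2)"
definition gam2 :: "real \<Rightarrow> real" where
  "gam2 r = poly polG2 (r\<^sup>2) / ((poly polP (r\<^sup>2))\<^sup>2 * poly polR (r\<^sup>2))"

text \<open>The first component carries one more power of \<open>1 / Q\<close> than the second,
  hence the partner exponents \<open>\<kappa> - 1\<close> and \<open>\<kappa> + 1\<close> in the two
  rows.\<close>

lemma elliptic_weighted:
  assumes Q: "\<And>s. s > 0 \<Longrightarrow> poly Q s > 0" and "r > 0"
  shows "elliptic beta (\<lambda>r. \<mu>\<^sup>2 + gam1 r) (\<lambda>r. \<mu> * alpha r) (weighted i \<kappa> Q n) (weighted i (\<kappa> - 1) Q n') r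
      = weighted i (\<kappa> + 2) Q (row1 \<mu> i \<kappa> Q n n') r / ((poly polP (r\<^sup>2))\<^sup>2 * (poly polR (r\<^sup>2))\<^sup>2)"
    and "elliptic beta (\<lambda>r. \<mu>\<^sup>2 + gam2 r) (\<lambda>r. \<mu> * alpha r) (weighted i \<kappa> Q n) (weighted i (\<kappa> + 1) Q n') r
      = weighted i (\<kappa> + 2) Q (row2 \<mu> i \<kappa> Q n n') r / ((poly polP (r\<^sup>2))\<^sup>2 * poly polR (r\<^sup>2))"
proof -
  define p q t R X w where defs: "p = poly polP (r\<^sup>2)" "q = poly polQ (r\<^sup>2)" "t = poly polT (r\<^sup>2)"
    "R = poly polR (r\<^sup>2)" "X = poly Q (r\<^sup>2) powr (- (\<kappa> + 2))" "w = poly Q (r\<^sup>2)"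
  have pos: "w > 0" "p > 0" "R > 0" using polP_pos polR_pos assms by (auto simp: defs)
  \<comment> \<open>All real powers of \<open>w\<close> become natural powers times
    \<open>X\<close>, which leaves a rational identity.\<close>
  have X_powr: "w powr (- (\<kappa> + 2) + a) = w powr a * X" for a
    by (simp only: powr_add defs(5) defs(6)[symmetric] mult.commute)
  have powr: "w powr (- (\<kappa> + 2)) = X" "w powr (- (\<kappa> + 1)) = w * X" "w powr (- \<kappa>) = w\<^sup>2 * X" "w powr (- (\<kappa> - 1)) = w ^ 3 * X"
    using X_powr[of 0] X_powr[of 1] X_powr[of 2] X_powr[of 3] pos
    by (simp_all add: powr_numeral algebra_simps)
  have e: "euler (weighted i \<kappa> Q n) r = weighted i (\<kappa> + 1) Q (wstep i \<kappa> Q n) r"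
    "euler (euler (weighted i \<kappa> Q n)) r = weighted i (\<kappa> + 2) Q (wstep i (\<kappa> + 1) Q (wstep i \<kappa> Q n)) r"
    using euler_weighted euler2_weighted assms by auto
  show "elliptic beta (\<lambda>r. \<mu>\<^sup>2 + gam1 r) (\<lambda>r. \<mu> * alpha r) (weighted i \<kappa> Q n) (weighted i (\<kappa> - 1) Q n') r
      = weighted i (\<kappa> + 2) Q (row1 \<mu> i \<kappa> Q n n') r / ((poly polP (r\<^sup>2))\<^sup>2 * (poly polR (r\<^sup>2))\<^sup>2)"
    unfolding elliptic_def e
    unfolding weighted_def row1_def beta_def gam1_def alpha_def defs[symmetric] powr
      poly_add poly_diff poly_smult poly_mult poly_power
    using pos by (simp add: field_simps power2_eq_square power3_eq_cube)
  show "elliptic beta (\<lambda>r. \<mu>\<^sup>2 + gam2 r) (\<lambda>r. \<mu> * alpha r) (weighted i \<kappa> Q n) (weighted i (\<kappa> + 1) Q n') r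
      = weighted i (\<kappa> + 2) Q (row2 \<mu> i \<kappa> Q n n') r / ((poly polP (r\<^sup>2))\<^sup>2 * poly polR (r\<^sup>2))"
    unfolding elliptic_def e
    unfolding weighted_def row2_def beta_def gam2_def alpha_def defs[symmetric] powr
      poly_add poly_diff poly_smult poly_mult poly_power
    using pos by (simp add: field_simps power2_eq_square power3_eq_cube)
qed

section \<open>The vortex profile and the coefficients of its linearization\<close>

lemma P0_eq: "P0 r = poly polP (r\<^sup>2)"
  by (simp add: P0_def polP_def algebra_simps flip: power_mult power_add power_Suc)

lemma polP_powr_half: "poly polP (r\<^sup>2) powr (- (1 / 2)) = 1 / sqrt (poly polP (r\<^sup>2))"
  using polP_pos[of "r\<^sup>2"] 
  by (simp only: powr_minus_divide) (simp add: powr_half_sqrt)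

lemma Phi2_eq: "Phi2 = weighted 2 (1/2) polP [:24, 1:]"
  by (simp add: Phi2_def weighted_def[abs_def] P0_eq polP_powr_half fun_eq_iff algebra_simps)

lemma deriv_Phi2:
  assumes "r > 0"
  shows "deriv Phi2 r = weighted 1 (3/2) polP polT r"
proof -
  have "wstep 2 (1/2) polP [:24, 1:] = polT"
    unfolding wstep_def polP_def polT_def by (simp add: pderiv_pCons)
  then have "(Phi2 has_real_derivative weighted 2 (3/2) polP polT r / r) (at r)"
    using weighted_deriv[of r polP 2 "1/2" "[:24, 1:]"] assms polP_pos[of "r\<^sup>2"] by (simp add: Phi2_eq)
  then show ?thesis using assms
    by (auto dest!: DERIV_imp_deriv simp: weighted_def power2_eq_square)
qed

text \<open>The coefficients contain \<open>Phi2\<close> and its derivative only in even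
  combinations, in which the half-integer powers of \<open>polP\<close> cancel.\<close>

lemma Phi2_squares:
  assumes "r > 0"
  shows "(Phi2 r)\<^sup>2 = (poly polQ (r\<^sup>2))\<^sup>2 / poly polP (r\<^sup>2)"
    and "(deriv Phi2 r)\<^sup>2 = r\<^sup>2 * (poly polT (r\<^sup>2))\<^sup>2 / poly polP (r\<^sup>2) ^ 3"
    and "r * (Phi2 r * deriv Phi2 r) = r\<^sup>2 * poly polQ (r\<^sup>2) * poly polT (r\<^sup>2) / (poly polP (r\<^sup>2))\<^sup>2"
    and "2 - (Phi2 r)\<^sup>2 = poly polR (r\<^sup>2) / poly polP (r\<^sup>2)"
proof -
  define p where "p = poly polP (r\<^sup>2)"
  have p: "p > 0" using polP_pos by (simp add: p_def)
  have Q: "poly polQ (r\<^sup>2) = r\<^sup>2 * (24 + r\<^sup>2)" by (simp add: polQ_def)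
  have Phi: "Phi2 r = poly polQ (r\<^sup>2) * p powr (- (1/2))"
    and Phi': "deriv Phi2 r = r * poly polT (r\<^sup>2) * p powr (- (3/2))"
    unfolding deriv_Phi2[OF assms] by (simp_all add: Phi2_eq weighted_def p_def Q)
  have X: "p powr (- (1/2)) * p powr (- (1/2)) = 1 / p" "p powr (- (3/2)) * p powr (- (3/2)) = 1 / p ^ 3"
    "p powr (- (1/2)) * p powr (- (3/2)) = 1 / p\<^sup>2"
    using p by (simp_all add: powr_minus_divide powr_numeral flip: powr_add)
  show 1: "(Phi2 r)\<^sup>2 = (poly polQ (r\<^sup>2))\<^sup>2 / poly polP (r\<^sup>2)"
    unfolding Phi p_def[symmetric] power_mult_distrib power2_eq_square[of "p powr _"] X by simp
  show "(deriv Phi2 r)\<^sup>2 = r\<^sup>2 * (poly polT (r\<^sup>2))\<^sup>2 / poly polP (r\<^sup>2) ^ 3"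
    unfolding Phi' p_def[symmetric] power_mult_distrib power2_eq_square[of "p powr _"] X by simp
  show "r * (Phi2 r * deriv Phi2 r) = r\<^sup>2 * poly polQ (r\<^sup>2) * poly polT (r\<^sup>2) / (poly polP (r\<^sup>2))\<^sup>2"
  proof -
    have "r * (Phi2 r * deriv Phi2 r)
      = r\<^sup>2 * poly polQ (r\<^sup>2) * poly polT (r\<^sup>2) * (p powr (- (1/2)) * p powr (- (3/2)))"
      unfolding Phi Phi' by (simp only: power2_eq_square[of r] mult_ac)
    then show ?thesis unfolding X by (simp add: p_def)
  qed
  show "2 - (Phi2 r)\<^sup>2 = poly polR (r\<^sup>2) / poly polP (r\<^sup>2)"
    using p unfolding 1 by (simp add: polR_eq p_def field_simps)
qed

lemma coefficients:
  assumes "r > 0"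
  shows "r * coeffB Phi2 r = beta r" "r\<^sup>2 * coeffA 2 Phi2 r = alpha r"
    "r\<^sup>2 * (coeffC 2 Phi2 r + coeffD 2 Phi2 r) = gam1 r"
    "r\<^sup>2 * (coeffC 2 Phi2 r - coeffD 2 Phi2 r) = gam2 r"
proof -
  define s where s: "s = r\<^sup>2"
  define p q t R where defs: "p = poly polP s" "q = poly polQ s" "t = poly polT s" "R = poly polR s"
  have pos: "p > 0" "R > 0" "s > 0" using polP_pos polR_pos assms by (auto simp: defs s)
  have q2: "q\<^sup>2 = 2 * p - R" by (simp add: defs polR_eq)
  note sq = Phi2_squares[OF assms, folded s, folded defs]
  have F: "(Phi2 r)\<^sup>2 = 2 - R / p" using sq(4) by simp
  have four: "x ^ 4 = (x\<^sup>2)\<^sup>2" for x :: real by simp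
  have "r * coeffB Phi2 r = - (2 * (r * (Phi2 r * deriv Phi2 r)) / (2 - (Phi2 r)\<^sup>2))"
    by (simp add: coeffB_def)
  also have "\<dots> = beta r"
    unfolding sq(3) F beta_def s[symmetric] defs[symmetric] using pos by (simp add: field_simps power2_eq_square)
  finally show "r * coeffB Phi2 r = beta r" .
  show "r\<^sup>2 * coeffA 2 Phi2 r = alpha r"
    unfolding coeffA_def alpha_def F s[symmetric] defs[symmetric] using pos by (simp add: field_simps)
  \<comment> \<open>Replacing \<open>q\<^sup>2\<close> by \<open>2 * p - R\<close> leaves a rational
    identity in \<open>p\<close>, \<open>R\<close>, \<open>s\<close> and \<open>t\<close>.\<close>
  have "r\<^sup>2 * (coeffC 2 Phi2 r + coeffD 2 Phi2 r)
      = (8 * ((2 * p + q\<^sup>2) * p ^ 3) - s\<^sup>2 * t\<^sup>2 * (q\<^sup>2 + 2 * p) + s / 2 * R\<^sup>2 * (9 * (q\<^sup>2 * p) - 5 * (q\<^sup>2)\<^sup>2 - 2 * p\<^sup>2))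
        / (p\<^sup>2 * R\<^sup>2)"
    unfolding coeffC_def coeffD_def four F sq(2) s[symmetric] q2 using pos
    by (simp add: field_simps power2_eq_square power3_eq_cube)
  then show "r\<^sup>2 * (coeffC 2 Phi2 r + coeffD 2 Phi2 r) = gam1 r"
    by (simp add: gam1_def polG1_def defs s power2_eq_square algebra_simps)
  have "r\<^sup>2 * (coeffC 2 Phi2 r - coeffD 2 Phi2 r)
      = (8 * p ^ 3 + s\<^sup>2 * t\<^sup>2 - s / 2 * (p - q\<^sup>2) * R\<^sup>2) / (p\<^sup>2 * R)"
    unfolding coeffC_def coeffD_def four F sq(2) s[symmetric] q2 using pos
    by (simp add: field_simps power2_eq_square power3_eq_cube)
  then show "r\<^sup>2 * (coeffC 2 Phi2 r - coeffD 2 Phi2 r) = gam2 r"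
    by (simp add: gam2_def polG2_def defs s power2_eq_square algebra_simps)
qed

section \<open>Logarithmic barriers\<close>

abbreviation (input) "log_barrier \<equiv> (\<lambda>r::real. ln r - 1 / r)"

lemma
  shows twice_diff_neg_ln: "twice_diff_on {0<..} (\<lambda>r. - ln r)"
    and elliptic_neg_ln: "r > 0 \<Longrightarrow>
      elliptic b c k (\<lambda>r. - ln r) (\<lambda>r. - ln r) r = - b r + (c r - k r) * (- ln r)"
proof -
  have 1: "((\<lambda>r. - ln r) has_real_derivative (- 1) / r) (at r)"
    and 2: "((\<lambda>r. - 1) has_real_derivative 0 / r) (at r)" if "r > 0" for r :: real
    using that by (auto intro!: derivative_eq_intros)
  note * = twice_diff_eulerI[of "\<lambda>r. - ln r" "\<lambda>r. - 1" "\<lambda>r. 0", OF 1 2]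
  show "twice_diff_on {0<..} (\<lambda>r. - ln r)" by (rule *(1))
  show "r > 0 \<Longrightarrow> elliptic b c k (\<lambda>r. - ln r) (\<lambda>r. - ln r) r = - b r + (c r - k r) * (- ln r)"
    by (simp add: elliptic_def *(2,3) algebra_simps)
qed

lemma
  shows twice_diff_log_barrier: "twice_diff_on {0<..} (\<lambda>r. x * log_barrier r)"
    and elliptic_log_barrier: "r > 0 \<Longrightarrow> elliptic b c k (\<lambda>r. x * log_barrier r) (\<lambda>r. y * log_barrier r) r
      = x * (1 / r + b r * (1 + 1 / r) + c r * log_barrier r) - y * (k r * log_barrier r)"
proof -
  have 1: "((\<lambda>r. x * log_barrier r) has_real_derivative x * (1 + 1 / r) / r) (at r)"
    and 2: "((\<lambda>r. x * (1 + 1 / r)) has_real_derivative x * (- 1 / r) / r) (at r)" if "r > 0" for r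
    using that by (auto intro!: derivative_eq_intros simp: field_simps power2_eq_square)
  note * = twice_diff_eulerI[of "\<lambda>r. x * log_barrier r" "\<lambda>r. x * (1 + 1 / r)" "\<lambda>r. x * (- 1 / r)", OF 1 2]
  show "twice_diff_on {0<..} (\<lambda>r. x * log_barrier r)" by (rule *(1))
  show "r > 0 \<Longrightarrow> elliptic b c k (\<lambda>r. x * log_barrier r) (\<lambda>r. y * log_barrier r) r
      = x * (1 / r + b r * (1 + 1 / r) + c r * log_barrier r) - y * (k r * log_barrier r)"
    by (simp add: elliptic_def *(2,3)) (simp add: algebra_simps)
qed

lemma log_barrier_at_top: "filterlim log_barrier at_top at_top"
proof -
  have "filterlim (\<lambda>r::real. - inverse r + ln r) at_top at_top"
    by (rule filterlim_tendsto_add_at_top[OF tendsto_minus[OF tendsto_inverse_0_at_top[OF filterlim_ident]] ln_at_top])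
  then show ?thesis by (simp add: divide_inverse)
qed

text \<open>At the ends the barriers are \<open>- ln r\<close> and \<open>ln r - 1 / r\<close>. The correction \<open>- 1 / r\<close> contributes \<open>1 / r\<close>
  to the operator; this is needed for the phase mode, whose coefficients are negative of order \<open>1 / r\<^sup>2\<close> at infinity.\<close>

lemma barrier_system_exists:
  fixes b c1 c2 k :: "real \<Rightarrow> real"
  assumes k: "\<And>r. r > 0 \<Longrightarrow> k r \<ge> 0"
    and lims: "(b \<longlongrightarrow> 0) (at_right 0)" "(c1 \<longlongrightarrow> C1) (at_right 0)" "(c2 \<longlongrightarrow> C2) (at_right 0)" "(k \<longlongrightarrow> K) (at_right 0)"
    and "K < C1" "K < C2" "x > 0"
    and outer: "\<forall>\<^sub>F r in at_top. x * (1 / r + b r * (1 + 1 / r) + c1 r * log_barrier r) - k r * log_barrier r > 0"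
      "\<forall>\<^sub>F r in at_top. 1 / r + b r * (1 + 1 / r) + c2 r * log_barrier r - x * (k r * log_barrier r) > 0"
  shows "\<exists>p0 q0. barrier_system b c1 c2 k (\<lambda>r. - ln r) (\<lambda>r. - ln r)
    (\<lambda>r. x * log_barrier r) (\<lambda>r. 1 * log_barrier r) p0 q0"
proof -
  interpret cooperative_system b c1 c2 k by standard (rule k)
  have ln0: "filterlim (\<lambda>r::real. - ln r) at_top (at_right 0)"
    using ln_at_0 by (simp add: filterlim_uminus_at_top)
  have pos: "\<forall>\<^sub>F r in at_right 0. - b r + (c r - k r) * (- ln r) > 0"
    if c: "(c \<longlongrightarrow> C) (at_right 0)" "K < C" for c C
  proof -
    \<comment> \<open>This \<open>d\<close> lies strictly between the limit 0 of \<open>b\<close>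
      and the limit \<open>C - K\<close> of \<open>c - k\<close>; once \<open>- ln r > 1\<close>,
      the barrier term exceeds \<open>d\<close> and \<open>b\<close> stays below it.\<close>
    define d where "d = (C - K) / 2"
    have "d > 0" "d < C - K" using \<open>K < C\<close> by (auto simp: d_def)
    have "\<forall>\<^sub>F r in at_right 0. c r - k r > d"
      by (rule order_tendstoD(1)[OF tendsto_diff[OF c(1) lims(4)] \<open>d < C - K\<close>])
    moreover have "\<forall>\<^sub>F r in at_right 0. b r < d"
      by (rule order_tendstoD(2)[OF lims(1) \<open>d > 0\<close>])
    moreover have "\<forall>\<^sub>F r::real in at_right 0. 1 < - ln r"
      using ln0 unfolding filterlim_at_top_dense by blast
    ultimately show ?thesis
    proof eventually_elim
      case (elim r)
      then have "d * 1 < (c r - k r) * (- ln r)"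
        using \<open>d > 0\<close> by (intro mult_strict_mono) auto
      then show ?case using elim by simp
    qed
  qed
  have "\<forall>\<^sub>F r::real in at_right 0. 0 < - ln r"
    using ln0 unfolding filterlim_at_top_dense by blast
  with pos[OF lims(2) \<open>K < C1\<close>] pos[OF lims(3) \<open>K < C2\<close>]
  have "\<forall>\<^sub>F r in at_right 0. - b r + (c1 r - k r) * (- ln r) > 0
      \<and> - b r + (c2 r - k r) * (- ln r) > 0 \<and> - ln r > 0"
    by eventually_elim auto
  then obtain p where p: "p > 0" "\<And>r. 0 < r \<Longrightarrow> r < p \<Longrightarrow> - b r + (c1 r - k r) * (- ln r) > 0
      \<and> - b r + (c2 r - k r) * (- ln r) > 0 \<and> - ln r > 0"
    unfolding eventually_at_right_field by blast
  have "\<forall>\<^sub>F r::real in at_top. 0 < log_barrier r"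
    using log_barrier_at_top unfolding filterlim_at_top_dense by blast
  with outer have "\<forall>\<^sub>F r in at_top. x * (1 / r + b r * (1 + 1 / r) + c1 r * log_barrier r) - k r * log_barrier r > 0
     \<and> 1 / r + b r * (1 + 1 / r) + c2 r * log_barrier r - x * (k r * log_barrier r) > 0 \<and> 0 < log_barrier r"
    by eventually_elim auto
  then obtain q where q: "\<And>r. r \<ge> q \<Longrightarrow> x * (1 / r + b r * (1 + 1 / r) + c1 r * log_barrier r) - k r * log_barrier r > 0
     \<and> 1 / r + b r * (1 + 1 / r) + c2 r * log_barrier r - x * (k r * log_barrier r) > 0 \<and> 0 < log_barrier r"
    unfolding eventually_at_top_linorder by blast
  define q0 where "q0 = max q p"
  have q0: "r > 0" "r \<ge> q" if "r \<ge> q0" for r using that p(1) by (auto simp: q0_def)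
  have inner: "strict_supersolution {0<..p / 2} (\<lambda>r. - ln r) (\<lambda>r. - ln r)"
    unfolding strict_supersolution_def
  proof (intro conjI ballI twice_diff_neg_ln)
    fix r assume "r \<in> {0<..p / 2}"
    then have r: "0 < r" "r < p" using p(1) by auto
    show "elliptic b c1 k (\<lambda>r. - ln r) (\<lambda>r. - ln r) r > 0" "elliptic b c2 k (\<lambda>r. - ln r) (\<lambda>r. - ln r) r > 0"
      unfolding elliptic_neg_ln[OF r(1)] using p(2)[OF r] by auto
  qed
  have outer: "strict_supersolution {q0..} (\<lambda>r. x * log_barrier r) (\<lambda>r. 1 * log_barrier r)"
    unfolding strict_supersolution_def
  proof (intro conjI ballI twice_diff_log_barrier)
    fix r assume "r \<in> {q0..}"
    then have r: "r > 0" "r \<ge> q" using q0 by auto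
    show "elliptic b c1 k (\<lambda>r. x * log_barrier r) (\<lambda>r. 1 * log_barrier r) r > 0"
      "elliptic b c2 k (\<lambda>r. 1 * log_barrier r) (\<lambda>r. x * log_barrier r) r > 0"
      unfolding elliptic_log_barrier[OF r(1)] using q[OF r(2)] by auto
  qed
  \<comment> \<open>The inequalities hold on the open interval up to \<open>p\<close>; halving
    \<open>p\<close> gives a closed one and makes it lie below \<open>q0\<close>.\<close>
  have "barrier_system b c1 c2 k (\<lambda>r. - ln r) (\<lambda>r. - ln r) (\<lambda>r. x * log_barrier r) (\<lambda>r. 1 * log_barrier r) (p / 2) q0"
  proof unfold_locales
    show "0 < p / 2" "p / 2 < q0" using p(1) by (auto simp: q0_def)
    show "- ln r > 0 \<and> - ln r > 0" if "0 < r" "r \<le> p / 2" for r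
      using p that by auto
    show "x * log_barrier r > 0 \<and> 1 * log_barrier r > 0" if "q0 \<le> r" for r
      using q[OF q0(2)[OF that]] \<open>x > 0\<close> by auto
    show "filterlim (\<lambda>r. x * log_barrier r) at_top at_top" "filterlim (\<lambda>r. 1 * log_barrier r) at_top at_top"
      by (rule filterlim_tendsto_pos_mult_at_top[OF tendsto_const _ log_barrier_at_top]; use \<open>x > 0\<close> in simp)+
  qed (fact inner outer ln0)+
  then show ?thesis by blast
qed

section \<open>Continuity, limits and bounds of the coefficients\<close>

lemma coefficients_continuous:
  "continuous_on {0<..} beta" "continuous_on {0<..} alpha" "continuous_on {0<..} gam1" "continuous_on {0<..} gam2"
proof -
  have "poly polP (r\<^sup>2) \<noteq> 0" "poly polR (r\<^sup>2) \<noteq> 0" for r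
    using polP_pos[of "r\<^sup>2"] polR_pos[of "r\<^sup>2"] by auto
  then show "continuous_on {0<..} beta" "continuous_on {0<..} alpha" "continuous_on {0<..} gam1" "continuous_on {0<..} gam2"
    unfolding beta_def[abs_def] alpha_def[abs_def] gam1_def[abs_def] gam2_def[abs_def]
    by (intro continuous_intros; simp)+
qed

text \<open>These limits fix the indicial exponents at 0: for mode \<open>\<mu>\<close> their
  squares are \<open>\<mu>^2 + 4 - 4 \<mu>\<close> and \<open>\<mu>^2 + 4 + 4 \<mu>\<close>, that
  is, \<open>(\<mu> - 2)^2\<close> and \<open>(\<mu> + 2)^2\<close>.\<close>

lemma coefficients_at_0:
  "(beta \<longlongrightarrow> 0) (at_right 0)" "(alpha \<longlongrightarrow> 4) (at_right 0)" "(gam1 \<longlongrightarrow> 4) (at_right 0)" "(gam2 \<longlongrightarrow> 4) (at_right 0)"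
proof -
  have nz: "poly polP (r\<^sup>2) \<noteq> 0" "poly polR (r\<^sup>2) \<noteq> 0" for r
    using polP_pos[of "r\<^sup>2"] polR_pos[of "r\<^sup>2"] by auto
  have lim: "(f \<longlongrightarrow> f 0) (at_right 0)" if "continuous_on UNIV f" for f :: "real \<Rightarrow> real"
    using that by (simp add: continuous_on_eq_continuous_at isCont_def filterlim_at_split)
  have "continuous_on UNIV beta" "continuous_on UNIV alpha" "continuous_on UNIV gam1" "continuous_on UNIV gam2"
    unfolding beta_def[abs_def] alpha_def[abs_def] gam1_def[abs_def] gam2_def[abs_def]
    by (intro continuous_intros; simp add: nz)+
  from this[THEN lim]
  show "(beta \<longlongrightarrow> 0) (at_right 0)" "(alpha \<longlongrightarrow> 4) (at_right 0)" "(gam1 \<longlongrightarrow> 4) (at_right 0)" "(gam2 \<longlongrightarrow> 4) (at_right 0)"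
    by (simp_all add: beta_def alpha_def gam1_def gam2_def polP_def polR_def polG1_eq polG2_eq)
qed

lemma alpha_bounds: "0 < alpha r" "alpha r \<le> 8"
proof -
  note pos = polP_pos[of "r\<^sup>2"] polR_pos[of "r\<^sup>2"]
  show "0 < alpha r" using pos by (simp add: alpha_def)
  have "polR - polP = [:36864, 9216, 576, 16:]" unfolding polR_def polP_def by simp
  moreover have "0 \<le> poly [:36864, 9216, 576, 16:] (r\<^sup>2)" by (intro poly_positivity) auto
  ultimately have "0 \<le> poly (polR - polP) (r\<^sup>2)" by simp
  then show "alpha r \<le> 8" using pos by (simp add: alpha_def field_simps)
qed

text \<open>The bound is the leading term at infinity: after clearing denominators the top-degree
  terms cancel and all remaining coefficients are positive. The bound for \<open>gam2\<close> arises
  in the same way.\<close>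

lemma beta_lower: "r > 0 \<Longrightarrow> beta r \<ge> - 32 / r\<^sup>2"
proof -
  assume r: "r > 0"
  define s where "s = r\<^sup>2"
  have s: "s > 0" using r by (simp add: s_def)
  note pos = polP_pos[of s] polR_pos[of s]
  have "smult 32 (polP * polR) - [:0, 0, 2:] * polQ * polT
      = [:86973087744, 43486543872, 10192158720, 1349517312, 107347968, 5308416, 163840, 2304:]"
    unfolding polR_def polP_def polQ_def polT_def by simp
  moreover have "0 \<le> poly [:86973087744, 43486543872, 10192158720, 1349517312, 107347968, 5308416, 163840, 2304:] s"
    using s by (intro poly_positivity) auto
  ultimately have "0 \<le> poly (smult 32 (polP * polR) - [:0, 0, 2:] * polQ * polT) s" by metis
  then have "2 * s * poly polQ s * poly polT s * s \<le> 32 * (poly polP s * poly polR s)"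
    by (simp add: algebra_simps)
  then show ?thesis using pos s
    unfolding beta_def s_def[symmetric] by (simp add: field_simps)
qed

lemma gam2_lower: "r > 0 \<Longrightarrow> gam2 r \<ge> - 32 / r\<^sup>2"
proof -
  assume r: "r > 0"
  define s where "s = r\<^sup>2"
  have s: "s > 0" using r by (simp add: s_def)
  note pos = polP_pos[of s] polR_pos[of s]
  have "[:0, 1:] * polG2 + smult 32 (polP\<^sup>2 * polR)
      = [:3206175906594816, 2805403918270464, 1077074718621696, 243176753332224, 35963371782144,
          3680048775168, 268393512960, 14316208128, 579207168, 17858560, 368640, 3328:]"
    unfolding polG2_eq polR_def polP_def power2_eq_square by simp
  moreover have "0 \<le> poly [:3206175906594816, 2805403918270464, 1077074718621696, 243176753332224, 35963371782144,
          3680048775168, 268393512960, 14316208128, 579207168, 17858560, 368640, 3328:] s"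
    using s by (intro poly_positivity) auto
  ultimately have "0 \<le> poly ([:0, 1:] * polG2 + smult 32 (polP\<^sup>2 * polR)) s" by metis
  then have "0 \<le> s * poly polG2 s + 32 * ((poly polP s)\<^sup>2 * poly polR s)"
    by (simp add: algebra_simps)
  then show ?thesis using pos s
    unfolding gam2_def s_def[symmetric] by (simp add: field_simps)
qed


text \<open>Again by comparison of coefficients. Here \<open>gam1\<close> grows like
  \<open>r^2\<close>, and a quarter of that growth is enough for the barriers.\<close>

lemma gam1_lower: "r > 0 \<Longrightarrow> gam1 r \<ge> r\<^sup>2 / 4"
proof -
  assume r: "r > 0"
  define s where "s = r\<^sup>2"
  have s: "s > 0" using r by (simp add: s_def)
  note pos = polP_pos[of s] polR_pos[of s]
  have "smult 4 polG1 - [:0, 1:] * (polP\<^sup>2 * polR\<^sup>2)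
      = [:118192468620711297024, 81257322176739016704, 22161087866383368192, 3629391126265331712,
      855247423084167168, 303334298662993920, 80012457585672192, 14245148095414272, 1789558253420544,
      164424585314304, 11250746523648, 575243550720, 21770862592, 596037632, 11338752, 140032, 992, 3:]"
    unfolding polG1_eq polR_def polP_def power2_eq_square by simp
  moreover have "0 \<le> poly [:118192468620711297024, 81257322176739016704, 22161087866383368192, 3629391126265331712,
      855247423084167168, 303334298662993920, 80012457585672192, 14245148095414272, 1789558253420544,
      164424585314304, 11250746523648, 575243550720, 21770862592, 596037632, 11338752, 140032, 992, 3:] s"
    using s by (intro poly_positivity) auto
  ultimately have "0 \<le> poly (smult 4 polG1 - [:0, 1:] * (polP\<^sup>2 * polR\<^sup>2)) s" by metis
  then have "s * ((poly polP s)\<^sup>2 * (poly polR s)\<^sup>2) \<le> 4 * poly polG1 s"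
    by simp
  then show ?thesis using pos s
    unfolding gam1_def s_def[symmetric] by (simp add: field_simps)
qed

lemma gam1_pos: "r > 0 \<Longrightarrow> gam1 r > 0"
  using gam1_lower[of r] by (smt (verit) divide_pos_pos zero_less_power)

text \<open>From \<open>r >= 23\<close> follow \<open>32 / r^2 <= 1/4\<close> and
  \<open>r^2 / 4 >= 129\<close>; the value 129 is what the first row of the mode barrier
  requires.\<close>

lemma outer_bounds:
  "\<forall>\<^sub>F r in at_top. r \<ge> 23 \<and> log_barrier r > 2 \<and> beta r * (1 + 1 / r) \<ge> - 1/2 \<and> gam2 r \<ge> - 1/4 \<and> gam1 r \<ge> 129"
proof -
  have "\<forall>\<^sub>F r::real in at_top. 2 < log_barrier r"
    using log_barrier_at_top unfolding filterlim_at_top_dense by blast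
  with eventually_ge_at_top[of 23] show ?thesis
  proof eventually_elim
    case (elim r)
    then have r: "r > 0" "r\<^sup>2 \<ge> 23\<^sup>2" using power_mono[of 23 r 2] by auto
    then have "32 / r\<^sup>2 \<le> 1/4" by (simp add: field_simps)
    then have b: "beta r \<ge> - (1/4)" "gam2 r \<ge> - (1/4)"
      using beta_lower[OF r(1)] gam2_lower[OF r(1)] by auto
    have "(- (1/4)) * (1 + 1 / r) \<le> beta r * (1 + 1 / r)"
      using b r by (intro mult_right_mono) auto
    moreover have "1 / r \<le> 1" using elim by (simp add: field_simps)
    then have "- 1/2 \<le> (- (1/4)) * (1 + 1 / r)" by simp
    ultimately have "beta r * (1 + 1 / r) \<ge> - 1/2" by (meson order_trans)
    then show ?case using elim b gam1_lower[OF r(1)] r by simp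
  qed
qed

text \<open>Near infinity \<open>alpha\<close> is close to 8 while only \<open>gam1\<close> grows,
  so the first component is scaled by \<open>\<mu> / 16\<close>. In the second row the coupling then
  costs at most half of \<open>\<mu>^2\<close>; in the first row,
  \<open>\<mu>^2 + gam1 >= 130\<close> exceeds \<open>16 * alpha <= 128\<close>.\<close>

lemma mode_barrier_system:
  assumes "\<mu> \<ge> 1" "\<mu> \<noteq> 2"
  shows "\<exists>p0 q0. barrier_system beta (\<lambda>r. \<mu>\<^sup>2 + gam1 r) (\<lambda>r. \<mu>\<^sup>2 + gam2 r) (\<lambda>r. \<mu> * alpha r)
    (\<lambda>r. - ln r) (\<lambda>r. - ln r) (\<lambda>r. \<mu> / 16 * log_barrier r) (\<lambda>r. 1 * log_barrier r) p0 q0"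
proof (rule barrier_system_exists)
  show "\<mu> * alpha r \<ge> 0" for r using assms alpha_bounds(1)[of r] by simp
  show "(beta \<longlongrightarrow> 0) (at_right 0)" by (rule coefficients_at_0)
  show "((\<lambda>r. \<mu>\<^sup>2 + gam1 r) \<longlongrightarrow> \<mu>\<^sup>2 + 4) (at_right 0)" "((\<lambda>r. \<mu>\<^sup>2 + gam2 r) \<longlongrightarrow> \<mu>\<^sup>2 + 4) (at_right 0)"
    "((\<lambda>r. \<mu> * alpha r) \<longlongrightarrow> \<mu> * 4) (at_right 0)"
    by (intro tendsto_intros coefficients_at_0)+
  \<comment> \<open>The gap between diagonal and coupling at 0 is this square; here mode 2 is
    excluded.\<close>
  have "0 < (\<mu> - 2)\<^sup>2" using assms by simp
  then show "\<mu> * 4 < \<mu>\<^sup>2 + 4" "\<mu> * 4 < \<mu>\<^sup>2 + 4" by (simp_all add: power2_eq_square algebra_simps)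
  show "\<mu> / 16 > 0" using assms by simp
  have \<mu>: "\<mu>\<^sup>2 \<ge> 1" using assms by simp
  show "\<forall>\<^sub>F r in at_top. \<mu> / 16 * (1 / r + beta r * (1 + 1 / r) + (\<mu>\<^sup>2 + gam1 r) * log_barrier r) - \<mu> * alpha r * log_barrier r > 0"
    using outer_bounds
  proof eventually_elim
    case (elim r)
    define z where "z = log_barrier r"
    have z: "z > 2" using elim by (simp add: z_def)
    have "130 * z \<le> (\<mu>\<^sup>2 + gam1 r) * z" using elim z \<mu> by (intro mult_right_mono) auto
    moreover have "1 / r \<ge> 0" using elim by simp
    ultimately have "1 / r + beta r * (1 + 1 / r) + (\<mu>\<^sup>2 + gam1 r) * z > 128 * z" using elim z by linarith
    then have "\<mu> / 16 * (1 / r + beta r * (1 + 1 / r) + (\<mu>\<^sup>2 + gam1 r) * z) > \<mu> / 16 * (128 * z)"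
      using assms by (intro mult_strict_left_mono) auto
    moreover have "\<mu> * z * alpha r \<le> \<mu> * z * 8" using alpha_bounds[of r] assms z by (intro mult_left_mono) auto
    ultimately show ?case unfolding z_def[symmetric] by (simp add: mult_ac)
  qed
  show "\<forall>\<^sub>F r in at_top. 1 / r + beta r * (1 + 1 / r) + (\<mu>\<^sup>2 + gam2 r) * log_barrier r - \<mu> / 16 * (\<mu> * alpha r * log_barrier r) > 0"
    using outer_bounds
  proof eventually_elim
    case (elim r)
    define z where "z = log_barrier r"
    have z: "z > 2" using elim by (simp add: z_def)
    have "\<mu>\<^sup>2 / 16 * alpha r \<le> \<mu>\<^sup>2 / 16 * 8" using alpha_bounds[of r] by (intro mult_left_mono) auto
    then have "(1/4) * z \<le> (\<mu>\<^sup>2 + gam2 r - \<mu>\<^sup>2 / 16 * alpha r) * z"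
      using elim z \<mu> by (intro mult_right_mono) auto
    moreover have "1 / r > 0" using elim by simp
    ultimately have "1 / r + beta r * (1 + 1 / r) + (\<mu>\<^sup>2 + gam2 r - \<mu>\<^sup>2 / 16 * alpha r) * z > 0"
      using elim z by linarith
    then show ?case unfolding z_def[symmetric] by (simp add: algebra_simps power2_eq_square)
  qed
qed

text \<open>For mode 0 each scalar equation is treated as two identical rows with zero
  coupling.\<close>

lemma amplitude_barrier_system:
  "\<exists>p0 q0. barrier_system beta gam1 gam1 (\<lambda>r. 0)
    (\<lambda>r. - ln r) (\<lambda>r. - ln r) (\<lambda>r. 1 * log_barrier r) (\<lambda>r. 1 * log_barrier r) p0 q0"
proof (rule barrier_system_exists)
  have *: "\<forall>\<^sub>F r in at_top. 1 / r + beta r * (1 + 1 / r) + gam1 r * log_barrier r > 0"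
    using outer_bounds
  proof eventually_elim
    case (elim r)
    then have "129 * 2 \<le> gam1 r * log_barrier r" by (intro mult_mono) auto
    moreover have "1 / r > 0" using elim by simp
    ultimately show ?case using elim by linarith
  qed
  then show "\<forall>\<^sub>F r in at_top. 1 * (1 / r + beta r * (1 + 1 / r) + gam1 r * log_barrier r) - 0 * log_barrier r > 0"
    "\<forall>\<^sub>F r in at_top. 1 / r + beta r * (1 + 1 / r) + gam1 r * log_barrier r - 1 * (0 * log_barrier r) > 0"
    by simp_all
qed (auto intro: coefficients_at_0)

lemma phase_barrier_system:
  "\<exists>p0 q0. barrier_system beta gam2 gam2 (\<lambda>r. 0)
    (\<lambda>r. - ln r) (\<lambda>r. - ln r) (\<lambda>r. 1 * log_barrier r) (\<lambda>r. 1 * log_barrier r) p0 q0"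
proof (rule barrier_system_exists)
  \<comment> \<open>Together with \<open>r > 64\<close> this keeps each of the losses
    \<open>32 / r\<close> and \<open>32 * (ln r / r)\<close> below one half of the gain.\<close>
  have "\<forall>\<^sub>F r::real in at_top. ln r / r < 1 / 64"
    by (rule order_tendstoD(2)[OF ln_x_over_x_tendsto_0]) simp
  then have *: "\<forall>\<^sub>F r in at_top. 1 / r + beta r * (1 + 1 / r) + gam2 r * log_barrier r > 0"
    using outer_bounds eventually_gt_at_top[of 64]
  proof eventually_elim
    case (elim r)
    have "- 32 / r\<^sup>2 * (1 + 1 / r) \<le> beta r * (1 + 1 / r)"
      using beta_lower[of r] elim by (intro mult_right_mono) auto
    moreover have "- 32 / r\<^sup>2 * log_barrier r \<le> gam2 r * log_barrier r"
      using gam2_lower[of r] elim by (intro mult_right_mono) auto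
    \<comment> \<open>The terms of order \<open>1 / r^3\<close> cancel.\<close>
    moreover have "1 / r + - 32 / r\<^sup>2 * (1 + 1 / r) + - 32 / r\<^sup>2 * log_barrier r = (1 - 32 / r - 32 * (ln r / r)) / r"
      using elim by (simp add: field_simps power2_eq_square)
    moreover have "32 / r < 1 / 2" using elim by (simp add: field_simps)
    then have "(1 - 32 / r - 32 * (ln r / r)) / r > 0"
      using elim by (intro divide_pos_pos) linarith+
    ultimately show ?case by linarith
  qed
  then show "\<forall>\<^sub>F r in at_top. 1 * (1 / r + beta r * (1 + 1 / r) + gam2 r * log_barrier r) - 0 * log_barrier r > 0"
    "\<forall>\<^sub>F r in at_top. 1 / r + beta r * (1 + 1 / r) + gam2 r * log_barrier r - 1 * (0 * log_barrier r) > 0"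
    by simp_all
qed (auto intro: coefficients_at_0)

text \<open>Multiplication of both rows by \<open>r^2\<close>. The coupling of the original operator
  is added, hence the minus sign in front of \<open>m\<close>.\<close>

lemma homogeneous_solution_elliptic:
  assumes "homogeneous_solution m u v" "r > 0"
  shows "elliptic beta (\<lambda>r. (real_of_int m)\<^sup>2 + gam1 r) (\<lambda>r. - real_of_int m * alpha r) u v r = 0"
    and "elliptic beta (\<lambda>r. (real_of_int m)\<^sup>2 + gam2 r) (\<lambda>r. - real_of_int m * alpha r) v u r = 0"
proof -
  have D: "twice_diff_on {0<..} u" "twice_diff_on {0<..} v" and "L2 m u v r = (0, 0)"
    using assms by (auto simp: homogeneous_solution_def)
  then have "r\<^sup>2 * fst (L2 m u v r) = 0" "r\<^sup>2 * snd (L2 m u v r) = 0" by simp_all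
  moreover have "r\<^sup>2 * fst (L2 m u v r) = elliptic beta (\<lambda>r. (real_of_int m)\<^sup>2 + gam1 r) (\<lambda>r. - real_of_int m * alpha r) u v r"
    using assms(2) unfolding L2_def vortex_mode_op_def elliptic_def
      twice_diff_derivs(5)[OF D(1) assms(2)] coefficients[OF assms(2), symmetric]
    by (simp add: euler_def field_simps power2_eq_square)
  moreover have "r\<^sup>2 * snd (L2 m u v r) = elliptic beta (\<lambda>r. (real_of_int m)\<^sup>2 + gam2 r) (\<lambda>r. - real_of_int m * alpha r) v u r"
    using assms(2) unfolding L2_def vortex_mode_op_def elliptic_def
      twice_diff_derivs(5)[OF D(2) assms(2)] coefficients[OF assms(2), symmetric]
    by (simp add: euler_def field_simps power2_eq_square)
  ultimately show "elliptic beta (\<lambda>r. (real_of_int m)\<^sup>2 + gam1 r) (\<lambda>r. - real_of_int m * alpha r) u v r = 0"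
    "elliptic beta (\<lambda>r. (real_of_int m)\<^sup>2 + gam2 r) (\<lambda>r. - real_of_int m * alpha r) v u r = 0"
    by auto
qed

section \<open>Bounded solutions for each mode\<close>

locale mode =
  fixes \<mu> :: real
  assumes mode: "\<mu> \<ge> 1" "\<mu> \<noteq> 2"

sublocale mode \<subseteq> cooperative_system beta "\<lambda>r. \<mu>\<^sup>2 + gam1 r" "\<lambda>r. \<mu>\<^sup>2 + gam2 r" "\<lambda>r. \<mu> * alpha r"
  by standard (use mode alpha_bounds in \<open>auto intro: less_imp_le\<close>)

text \<open>Flipping the sign of one component makes the coupling cooperative.\<close>

lemma homogeneous_solution_cooperative:
  assumes sol: "homogeneous_solution m u v" and "m \<noteq> 0" "m \<noteq> 2" "m \<noteq> - 2"
  shows "mode \<bar>real_of_int m\<bar>"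
    and "cooperative_system.solution beta (\<lambda>r. \<bar>real_of_int m\<bar>\<^sup>2 + gam1 r) (\<lambda>r. \<bar>real_of_int m\<bar>\<^sup>2 + gam2 r)
      (\<lambda>r. \<bar>real_of_int m\<bar> * alpha r) (\<lambda>r. - real_of_int (sgn m) * u r + 0 * u r) v"
proof -
  show "mode \<bar>real_of_int m\<bar>" using assms by (unfold mode_def) linarith
  then interpret mode "\<bar>real_of_int m\<bar>" .
  have D: "twice_diff_on {0<..} u" "twice_diff_on {0<..} v" using sol by (auto simp: homogeneous_solution_def)
  show "solution (\<lambda>r. - real_of_int (sgn m) * u r + 0 * u r) v"
    unfolding solution_def
  proof (intro conjI allI impI)
    show "twice_diff_on {0<..} (\<lambda>r. - real_of_int (sgn m) * u r + 0 * u r)"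
      by (rule twice_diff_comb[OF D(1) D(1)])
    show "twice_diff_on {0<..} v" by (rule D(2))
    fix r :: real assume r: "r > 0"
    \<comment> \<open>The factor \<open>- sgn m\<close> turns the coupling
      \<open>- m * alpha\<close> into \<open>\<bar>m\<bar> * alpha\<close>.\<close>
    have "elliptic beta (\<lambda>r. \<bar>real_of_int m\<bar>\<^sup>2 + gam1 r) (\<lambda>r. \<bar>real_of_int m\<bar> * alpha r)
        (\<lambda>r. - real_of_int (sgn m) * u r + 0 * u r) v r
      = - real_of_int (sgn m) * elliptic beta (\<lambda>r. (real_of_int m)\<^sup>2 + gam1 r) (\<lambda>r. - real_of_int m * alpha r) u v r"
      unfolding elliptic_def euler_comb[OF D(1) D(1) r] euler2_comb[OF D(1) D(1) r]
      using \<open>m \<noteq> 0\<close> by (cases "m > 0") (simp_all add: algebra_simps)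
    then show "elliptic beta (\<lambda>r. \<bar>real_of_int m\<bar>\<^sup>2 + gam1 r) (\<lambda>r. \<bar>real_of_int m\<bar> * alpha r)
        (\<lambda>r. - real_of_int (sgn m) * u r + 0 * u r) v r = 0"
      using homogeneous_solution_elliptic(1)[OF sol r] by simp
    have "elliptic beta (\<lambda>r. \<bar>real_of_int m\<bar>\<^sup>2 + gam2 r) (\<lambda>r. \<bar>real_of_int m\<bar> * alpha r)
        v (\<lambda>r. - real_of_int (sgn m) * u r + 0 * u r) r
      = elliptic beta (\<lambda>r. (real_of_int m)\<^sup>2 + gam2 r) (\<lambda>r. - real_of_int m * alpha r) v u r"
      unfolding elliptic_def using \<open>m \<noteq> 0\<close> by (cases "m > 0") (simp_all add: algebra_simps)
    then show "elliptic beta (\<lambda>r. \<bar>real_of_int m\<bar>\<^sup>2 + gam2 r) (\<lambda>r. \<bar>real_of_int m\<bar> * alpha r)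
        v (\<lambda>r. - real_of_int (sgn m) * u r + 0 * u r) r = 0"
      using homogeneous_solution_elliptic(2)[OF sol r] by simp
  qed
qed

lemma (in mode) bounded_solution_large:
  assumes "\<mu> \<ge> 4" and sol: "solution f g"
    and bound: "\<And>r. r > 0 \<Longrightarrow> \<bar>f r\<bar> \<le> B \<and> \<bar>g r\<bar> \<le> B" and "r > 0"
  shows "f r = 0 \<and> g r = 0"
proof -
  obtain p0 q0 where "barrier_system beta (\<lambda>r. \<mu>\<^sup>2 + gam1 r) (\<lambda>r. \<mu>\<^sup>2 + gam2 r) (\<lambda>r. \<mu> * alpha r)
    (\<lambda>r. - ln r) (\<lambda>r. - ln r) (\<lambda>r. \<mu> / 16 * log_barrier r) (\<lambda>r. 1 * log_barrier r) p0 q0"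
    using mode_barrier_system[OF mode] by blast
  then interpret barrier_system beta "\<lambda>r. \<mu>\<^sup>2 + gam1 r" "\<lambda>r. \<mu>\<^sup>2 + gam2 r" "\<lambda>r. \<mu> * alpha r"
    "\<lambda>r. - ln r" "\<lambda>r. - ln r" "\<lambda>r. \<mu> / 16 * log_barrier r" "\<lambda>r. 1 * log_barrier r" p0 q0 .
  \<comment> \<open>The rational pair found for \<open>\<mu> = 4 + j\<close>, used with
    \<open>j = \<mu> - 4\<close>.\<close>
  define U V where "U = weighted 1 2 [:10, 1:] [:115, 4:]" and "V = weighted 1 1 [:10, 1:] [:10:]"
  have Q: "poly [:10, 1:] s > 0" if "s > 0" for s :: real using that by simp
  have j: "\<mu> = 4 + (\<mu> - 4)" "\<mu> - 4 \<ge> 0" using assms by auto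
  have "strict_supersolution {0<..} U V"
    unfolding strict_supersolution_def
  proof (intro conjI ballI)
    show "twice_diff_on {0<..} U" "twice_diff_on {0<..} V"
      unfolding U_def V_def by (intro twice_diff_weighted Q; assumption)+
    fix r :: real assume "r \<in> {0<..}"
    then have r: "r > 0" "r\<^sup>2 > 0" by auto
    have "weighted 1 4 [:10, 1:] (row1 \<mu> 1 2 [:10, 1:] [:115, 4:] [:10:]) r > 0"
      using poly_row1_large_pos[OF j(2) r(2)] r Q[OF r(2)] by (simp add: weighted_def)
    then show "elliptic beta (\<lambda>r. \<mu>\<^sup>2 + gam1 r) (\<lambda>r. \<mu> * alpha r) U V r > 0"
      using elliptic_weighted(1)[of "[:10, 1:]" r \<mu> 1 2 "[:115, 4:]" "[:10:]"] Q r polP_pos[of "r\<^sup>2"] polR_pos[of "r\<^sup>2"]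
      by (simp add: U_def V_def)
    have "weighted 1 3 [:10, 1:] (row2 \<mu> 1 1 [:10, 1:] [:10:] [:115, 4:]) r > 0"
      using poly_row2_large_pos[OF j(2) r(2)] r Q[OF r(2)] by (simp add: weighted_def)
    then show "elliptic beta (\<lambda>r. \<mu>\<^sup>2 + gam2 r) (\<lambda>r. \<mu> * alpha r) V U r > 0"
      using elliptic_weighted(2)[of "[:10, 1:]" r \<mu> 1 1 "[:10:]" "[:115, 4:]"] Q r polP_pos[of "r\<^sup>2"] polR_pos[of "r\<^sup>2"]
      by (simp add: U_def V_def)
  qed
  moreover have "U r > 0 \<and> V r > 0" if "r > 0" for r
  proof -
    have "10 + r\<^sup>2 > 0" "10 + r\<^sup>2 \<noteq> 0" "115 + r\<^sup>2 * 4 > 0" using zero_le_power2[of r] by linarith+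
    then show ?thesis using that by (simp add: U_def V_def weighted_def zero_less_mult_iff)
  qed
  ultimately show ?thesis using bounded_solution_zero sol bound \<open>r > 0\<close> by blast
qed

text \<open>The common argument for modes 1 and 3: vanishing rows make the weighted pair a solution,
  positive numerators make it a ground state.\<close>

lemma (in mode) bounded_solution_multiple:
  assumes rows: "row1 \<mu> 1 (3/2) polP n n' = 0" "row2 \<mu> 1 (1/2) polP n' n = 0"
    and pos: "\<And>s. s > 0 \<Longrightarrow> poly n s > 0 \<and> poly n' s > 0"
    and sol: "solution f g"
    and bound: "\<And>r. r > 0 \<Longrightarrow> \<bar>f r\<bar> \<le> B \<and> \<bar>g r\<bar> \<le> B"
  shows "\<exists>M. \<forall>r>0. f r = M * weighted 1 (3/2) polP n r \<and> g r = M * weighted 1 (1/2) polP n' r"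
proof -
  obtain p0 q0 where "barrier_system beta (\<lambda>r. \<mu>\<^sup>2 + gam1 r) (\<lambda>r. \<mu>\<^sup>2 + gam2 r) (\<lambda>r. \<mu> * alpha r)
    (\<lambda>r. - ln r) (\<lambda>r. - ln r) (\<lambda>r. \<mu> / 16 * log_barrier r) (\<lambda>r. 1 * log_barrier r) p0 q0"
    using mode_barrier_system[OF mode] by blast
  then interpret barrier_system beta "\<lambda>r. \<mu>\<^sup>2 + gam1 r" "\<lambda>r. \<mu>\<^sup>2 + gam2 r" "\<lambda>r. \<mu> * alpha r"
    "\<lambda>r. - ln r" "\<lambda>r. - ln r" "\<lambda>r. \<mu> / 16 * log_barrier r" "\<lambda>r. 1 * log_barrier r" p0 q0 .
  have P: "poly polP s > 0" if "s > 0" for s using polP_pos that by simp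
  show ?thesis
  proof (rule bounded_solution_ground_state[OF _ _ sol bound])
    show "solution (weighted 1 (3/2) polP n) (weighted 1 (1/2) polP n')"
      unfolding solution_def
    proof (intro conjI allI impI)
      show "twice_diff_on {0<..} (weighted 1 (3/2) polP n)" "twice_diff_on {0<..} (weighted 1 (1/2) polP n')"
        by (intro twice_diff_weighted P; assumption)+
      fix r :: real assume r: "r > 0"
      show "elliptic beta (\<lambda>r. \<mu>\<^sup>2 + gam1 r) (\<lambda>r. \<mu> * alpha r) (weighted 1 (3/2) polP n) (weighted 1 (1/2) polP n') r = 0"
        using elliptic_weighted(1)[of polP r \<mu> 1 "3/2" n n'] P r by (simp add: rows weighted_def del: One_nat_def)
      show "elliptic beta (\<lambda>r. \<mu>\<^sup>2 + gam2 r) (\<lambda>r. \<mu> * alpha r) (weighted 1 (1/2) polP n') (weighted 1 (3/2) polP n) r = 0"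
        using elliptic_weighted(2)[of polP r \<mu> 1 "1/2" n' n] P r by (simp add: rows weighted_def del: One_nat_def)
    qed
    show "0 < weighted 1 (3/2) polP n r \<and> 0 < weighted 1 (1/2) polP n' r" if "r > 0" for r
    proof -
      have "r\<^sup>2 > 0" using that by simp
      with that show ?thesis using pos P by (simp add: weighted_def less_imp_neq[symmetric])
    qed
    show "continuous_on {0<..} beta" "continuous_on {0<..} (\<lambda>r. \<mu>\<^sup>2 + gam1 r)" "continuous_on {0<..} (\<lambda>r. \<mu>\<^sup>2 + gam2 r)"
      "continuous_on {0<..} (\<lambda>r. \<mu> * alpha r)"
      by (intro continuous_intros coefficients_continuous)+
    show "(\<forall>r>0. 0 < \<mu> * alpha r) \<or> (f = g \<and> weighted 1 (3/2) polP n = weighted 1 (1/2) polP n')"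
      using mode alpha_bounds by auto
  qed
qed

lemma bounded_amplitude_zero:
  assumes D: "twice_diff_on {0<..} u" and eq: "\<And>r. r > 0 \<Longrightarrow> elliptic beta gam1 (\<lambda>r. 0) u u r = 0"
    and bound: "\<And>r. r > 0 \<Longrightarrow> \<bar>u r\<bar> \<le> B" and "r > 0"
  shows "u r = 0"
proof -
  obtain p0 q0 where "barrier_system beta gam1 gam1 (\<lambda>r. 0)
    (\<lambda>r. - ln r) (\<lambda>r. - ln r) (\<lambda>r. 1 * log_barrier r) (\<lambda>r. 1 * log_barrier r) p0 q0"
    using amplitude_barrier_system by blast
  then interpret barrier_system beta gam1 gam1 "\<lambda>r. 0"
    "\<lambda>r. - ln r" "\<lambda>r. - ln r" "\<lambda>r. 1 * log_barrier r" "\<lambda>r. 1 * log_barrier r" p0 q0 .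
  have one: "twice_diff_on {0<..} (\<lambda>r. 1)" "euler (\<lambda>r. 1) r = 0" "euler (euler (\<lambda>r. 1)) r = 0" if "r > 0" for r
    using twice_diff_eulerI[of "\<lambda>r. 1" "\<lambda>r. 0" "\<lambda>r. 0"] that by auto
  have "strict_supersolution {0<..} (\<lambda>r. 1) (\<lambda>r. 1)"
    unfolding strict_supersolution_def elliptic_def using one(1)[of 1] one(2,3) gam1_pos by simp
  moreover have "solution u u" unfolding solution_def using D eq by blast
  ultimately show ?thesis using bounded_solution_zero[of "\<lambda>r. 1" "\<lambda>r. 1" u u B r] bound \<open>r > 0\<close> by auto
qed

lemma bounded_phase_multiple:
  assumes D: "twice_diff_on {0<..} v" and eq: "\<And>r. r > 0 \<Longrightarrow> elliptic beta gam2 (\<lambda>r. 0) v v r = 0"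
    and bound: "\<And>r. r > 0 \<Longrightarrow> \<bar>v r\<bar> \<le> B"
  shows "\<exists>M. \<forall>r>0. v r = M * Phi2 r"
proof -
  obtain p0 q0 where "barrier_system beta gam2 gam2 (\<lambda>r. 0)
    (\<lambda>r. - ln r) (\<lambda>r. - ln r) (\<lambda>r. 1 * log_barrier r) (\<lambda>r. 1 * log_barrier r) p0 q0"
    using phase_barrier_system by blast
  then interpret barrier_system beta gam2 gam2 "\<lambda>r. 0"
    "\<lambda>r. - ln r" "\<lambda>r. - ln r" "\<lambda>r. 1 * log_barrier r" "\<lambda>r. 1 * log_barrier r" p0 q0 .
  have P: "poly polP s > 0" if "s > 0" for s using polP_pos that by simp
  have "elliptic beta gam2 (\<lambda>r. 0) Phi2 Phi2 r = 0" if "r > 0" for r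
    \<comment> \<open>The partner numerator is set to 0, since \<open>\<mu> = 0\<close> removes the
      coupling.\<close>
    using elliptic_weighted(2)[of polP r 0 2 "1/2" "[:24, 1:]" 0] P that row_phase
    by (simp add: Phi2_eq weighted_def elliptic_def)
  moreover have D': "twice_diff_on {0<..} Phi2" unfolding Phi2_eq by (intro twice_diff_weighted P)
  ultimately have Phi: "solution Phi2 Phi2" unfolding solution_def by blast
  have "solution v v" unfolding solution_def using D eq by blast
  moreover have "Phi2 r > 0 \<and> Phi2 r > 0" if "r > 0" for r
    using that polP_pos[of "r\<^sup>2"] by (simp add: Phi2_def P0_eq add_pos_pos)
  ultimately have "\<exists>M. \<forall>r>0. v r = M * Phi2 r \<and> v r = M * Phi2 r"
    using bound coefficients_continuous by (intro bounded_solution_ground_state[OF Phi]) auto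
  then show ?thesis by blast
qed

text \<open>For each mode treated, the bounded solutions are multiples of a single spanning element,
  so a singleton suffices.\<close>

lemma span_fun_on_multiple:
  assumes "g \<in> B" "\<And>x. x \<in> S \<Longrightarrow> f x = c *\<^sub>R g x"
  shows "f \<in> span_fun_on S B"
  unfolding span_fun_on_def using assms by (auto intro!: exI[of _ "{g}"] exI[of _ "\<lambda>_. c"])

text \<open>The weighted forms of the known kernel elements; the minus sign before \<open>u3\<close>
  is the sign flip that makes the first component positive.\<close>

lemma weighted_kernel:
  assumes "r > 0"
  shows "weighted 1 (1/2) polP [:48, 2:] r = 2 / r * Phi2 r"
    and "weighted 1 (3/2) polP [:36864, 9216, 768, 24:] r = - u3 r"
    and "weighted 1 (1/2) polP [:1:] r = v3 r"
proof -
  show "weighted 1 (1/2) polP [:48, 2:] r = 2 / r * Phi2 r"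
    unfolding Phi2_eq weighted_def using assms by (simp add: field_simps power2_eq_square)
  have "poly [:36864, 9216, 768, 24:] (r\<^sup>2) = 24 * (r ^ 6 + 32 * r ^ 4 + 384 * r ^ 2 + 1536)"
    by (simp add: algebra_simps flip: power_mult power_add power_Suc)
  then show "weighted 1 (3/2) polP [:36864, 9216, 768, 24:] r = - u3 r"
    unfolding weighted_def u3_def P0_eq by (simp add: powr_minus_divide)
  show "weighted 1 (1/2) polP [:1:] r = v3 r"
    unfolding weighted_def polP_powr_half v3_def P0_eq by simp
qed

text \<open>The five spanning functions belong to modes 0, 1, -1, 3 and -3, in this order; for every
  other admissible mode the bounded solution vanishes.\<close>

theorem lemma16:
  fixes m :: int and u v :: "real \<Rightarrow> real"
  assumes "m \<noteq> 2" and "m \<noteq> -2"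
    and "homogeneous_solution m u v"
    and "bounded (u ` {0<..})" and "bounded (v ` {0<..})"
  shows "(\<lambda>r. (u r, v r)) \<in> span_fun_on {0<..}
           {\<lambda>r. (0, Phi2 r),
            \<lambda>r. (deriv Phi2 r, - (2 / r) * Phi2 r),
            \<lambda>r. (deriv Phi2 r, 2 / r * Phi2 r),
            \<lambda>r. (u3 r, v3 r),
            \<lambda>r. (u3 r, - v3 r)}"
proof -
  obtain B1 where B1: "\<And>r. r > 0 \<Longrightarrow> \<bar>u r\<bar> \<le> B1" using assms(4) unfolding bounded_iff by auto
  obtain B2 where B2: "\<And>r. r > 0 \<Longrightarrow> \<bar>v r\<bar> \<le> B2" using assms(5) unfolding bounded_iff by auto
  have D: "twice_diff_on {0<..} u" "twice_diff_on {0<..} v"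
    using assms(3) by (auto simp: homogeneous_solution_def)
  consider (zero) "m = 0" | (small) "m \<noteq> 0" "\<bar>m\<bar> = 1 \<or> \<bar>m\<bar> = 3" | (large) "m \<noteq> 0" "\<bar>m\<bar> \<ge> 4"
    using assms(1,2) by linarith
  then show ?thesis
  proof cases
    case zero
    have "elliptic beta gam1 (\<lambda>r. 0) u u r = 0" "elliptic beta gam2 (\<lambda>r. 0) v v r = 0" if "r > 0" for r
      using homogeneous_solution_elliptic[OF assms(3) that] zero by (simp_all add: elliptic_def)
    then have "u r = 0" "\<exists>M. \<forall>r>0. v r = M * Phi2 r" if "r > 0" for r
      using bounded_amplitude_zero[OF D(1) _ B1] bounded_phase_multiple[OF D(2) _ B2] that by auto
    then obtain M where "\<forall>r>0. u r = 0 \<and> v r = M * Phi2 r" by (metis zero_less_one)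
    then show ?thesis by (intro span_fun_on_multiple[where g = "\<lambda>r. (0, Phi2 r)" and c = M]) auto
  next
    case large
    note coop = homogeneous_solution_cooperative[OF assms(3) large(1) assms(1,2)]
    interpret mode "\<bar>real_of_int m\<bar>" by (rule coop(1))
    have "\<bar>real_of_int m\<bar> \<ge> 4" using large by linarith
    moreover have "\<bar>- real_of_int (sgn m) * u r + 0 * u r\<bar> \<le> max B1 B2 \<and> \<bar>v r\<bar> \<le> max B1 B2" if "r > 0" for r
      using B1[OF that] B2[OF that] by (auto simp: abs_mult sgn_if)
    ultimately have "- real_of_int (sgn m) * u r + 0 * u r = 0 \<and> v r = 0" if "r > 0" for r
      using bounded_solution_large[OF _ coop(2)] that by blast
    moreover have "real_of_int (sgn m) \<noteq> 0" using large(1) by (simp add: sgn_eq_0_iff)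
    ultimately have "u r = 0 \<and> v r = 0" if "r > 0" for r using that by force
    \<comment> \<open>The zero function is the zero multiple of any spanning element.\<close>
    then show ?thesis by (intro span_fun_on_multiple[where g = "\<lambda>r. (0, Phi2 r)" and c = 0]) auto
  next
    case small
    note coop = homogeneous_solution_cooperative[OF assms(3) small(1) assms(1,2)]
    interpret mode "\<bar>real_of_int m\<bar>" by (rule coop(1))
    have bound: "\<bar>- real_of_int (sgn m) * u r + 0 * u r\<bar> \<le> max B1 B2 \<and> \<bar>v r\<bar> \<le> max B1 B2" if "r > 0" for r
      using B1[OF that] B2[OF that] by (auto simp: abs_mult sgn_if)
    show ?thesis
    proof (cases "\<bar>m\<bar> = 1")
      case True
      then have \<mu>: "\<bar>real_of_int m\<bar> = 1" by linarith
      have "\<exists>M. \<forall>r>0. - real_of_int (sgn m) * u r + 0 * u r = M * weighted 1 (3/2) polP polT r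
          \<and> v r = M * weighted 1 (1/2) polP [:48, 2:] r"
        by (rule bounded_solution_multiple[OF _ _ _ coop(2) bound]) (simp_all add: \<mu> row_translation polT_pos del: One_nat_def)
      then obtain M where *: "\<forall>r>0. - real_of_int (sgn m) * u r + 0 * u r = M * weighted 1 (3/2) polP polT r
          \<and> v r = M * weighted 1 (1/2) polP [:48, 2:] r" ..
      have M: "- real_of_int (sgn m) * u r = M * deriv Phi2 r \<and> v r = M * (2 / r * Phi2 r)" if "r > 0" for r
        using * that unfolding deriv_Phi2[OF that] weighted_kernel(1)[OF that, symmetric] by simp
      from True consider "m = 1" | "m = - 1" by linarith
      then show ?thesis
      proof cases
        case 1
        \<comment> \<open>For \<open>m = 1\<close> undoing the flip negates \<open>u\<close>, so the
          factor is \<open>- M\<close> and the second entry of the spanning element is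
          negative.\<close>
        have "u r = - M * deriv Phi2 r" if "r > 0" for r using M[OF that] 1 by simp
        then show ?thesis using M
          by (intro span_fun_on_multiple[where g = "\<lambda>r. (deriv Phi2 r, - (2 / r) * Phi2 r)" and c = "- M"]) auto
      next
        case 2
        then show ?thesis using M
          by (intro span_fun_on_multiple[where g = "\<lambda>r. (deriv Phi2 r, 2 / r * Phi2 r)" and c = M]) auto
      qed
    next
      case False
      then have \<mu>: "\<bar>real_of_int m\<bar> = 3" using small by linarith
      have "\<exists>M. \<forall>r>0. - real_of_int (sgn m) * u r + 0 * u r = M * weighted 1 (3/2) polP [:36864, 9216, 768, 24:] r
          \<and> v r = M * weighted 1 (1/2) polP [:1:] r"
        by (rule bounded_solution_multiple[OF _ _ _ coop(2) bound]) (simp_all add: \<mu> row_mode3 add_pos_pos del: One_nat_def)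
      then obtain M where *: "\<forall>r>0. - real_of_int (sgn m) * u r + 0 * u r
          = M * weighted 1 (3/2) polP [:36864, 9216, 768, 24:] r \<and> v r = M * weighted 1 (1/2) polP [:1:] r" ..
      have M: "- real_of_int (sgn m) * u r = M * - u3 r \<and> v r = M * v3 r" if "r > 0" for r
        using * that unfolding weighted_kernel(2,3)[OF that, symmetric] by simp
      from False small consider "m = 3" | "m = - 3" by linarith
      then show ?thesis
      proof cases
        case 1
        then show ?thesis using M
          by (intro span_fun_on_multiple[where g = "\<lambda>r. (u3 r, v3 r)" and c = M]) auto
      next
        case 2
        then show ?thesis using M
          \<comment> \<open>For \<open>m = - 3\<close> there is no flip: \<open>u = - M * u3\<close>
            and \<open>v = M * v3\<close>.\<close>
          by (intro span_fun_on_multiple[where g = "\<lambda>r. (u3 r, - v3 r)" and c = "- M"]) auto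
      qed
    qed
  qed
qed

end
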